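(* Let $\mathsf{A}$ be a homological category with zero object $0$, and let $U\colon \mathsf{B}\to\mathsf{A}$ be a conservative faithful functor with a left adjoint $F\colon\mathsf{A}\to\mathsf{B}$ and unit $\eta\colon \mathrm{id}_{\mathsf{A}}\to UF$. Put $I := F(0)$, which is an initial object of $\mathsf{B}$. For each object $A$ of $\mathsf{A}$, let $p_A\colon F(A)\to I$ be the unique morphism of $\mathsf{B}$ such that $U(p_A)\circ\eta_A$ is the zero morphism $A\to U(I)$. Suppose that for every object $A$ of $\mathsf{A}$ the morphism $\eta_A\colon A\to UF(A)$ is a kernel of $U(p_A)$ in $\mathsf{A}$. Then the kernel functor \[ K\colon \mathsf{B}/I\to\mathsf{A}, \] defined on an object $f\colon B\to I$ of the slice category by $K(f) := \mathrm{Ker}(U(f))$, the kernel being computed in $\mathsf{A}$ (and on morphisms by the induced morphism between kernels), is an equivalence of categories.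
   Context: For a category $\mathsf{C}$ and an object $J$ of $\mathsf{C}$, $\mathrm{Pt}_{\mathsf{C}}(J)$ denotes the category of points over $J$: objects are triples $(B,p,s)$ with $p\colon B\to J$, $s\colon J\to B$ and $p\circ s=\mathrm{id}_J$; a morphism $(B',p',s')\to(B,p,s)$ is a morphism $f\colon B'\to B$ with $p\circ f=p'$ and $f\circ s'=s$. If $\mathsf{C}$ has pullbacks, any $g\colon J'\to J$ induces by pullback a functor $g^*\colon \mathrm{Pt}_{\mathsf{C}}(J)\to\mathrm{Pt}_{\mathsf{C}}(J')$ (with the induced section). The category $\mathsf{C}$ is protomodular if every such $g^*$ is conservative, i.e. reflects isomorphisms. A category is regular if it is finitely complete, regular epimorphisms are pullback-stable, and every effective equivalence relation (kernel pair of some morphism) has a coequalizer. A category is pointed if it has a zero object $0$ (both initial and terminal). A homological category is a pointed, regular, protomodular category. In a pointed category, the kernel of $p\colon B\to J$ is the pullback of $p$ along $0\to J$. A functor is conservative if it reflects isomorphisms. *)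

theory Defs
  imports Main
begin

section \<open>Categories, functors, natural transformations\<close>

record ('o, 'm) category =
  Obj :: "'o set"
  Arr :: "'m set"
  Dom :: "'m \<Rightarrow> 'o"
  Cod :: "'m \<Rightarrow> 'o"
  Id :: "'o \<Rightarrow> 'm"
  Comp :: "'m \<Rightarrow> 'm \<Rightarrow> 'm"  (infixr "\<cdot>\<index>" 70)

definition hom :: "('o, 'm) category \<Rightarrow> 'o \<Rightarrow> 'o \<Rightarrow> 'm set" where
  "hom C x y = {f \<in> Arr C. Dom C f = x \<and> Cod C f = y}"

locale category =
  fixes C :: "('o, 'm) category" (structure)
  assumes Dom_Obj: "f \<in> Arr C \<Longrightarrow> Dom C f \<in> Obj C"
    and Cod_Obj: "f \<in> Arr C \<Longrightarrow> Cod C f \<in> Obj C"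
    and Id_hom: "x \<in> Obj C \<Longrightarrow> Id C x \<in> hom C x x"
    and Comp_hom: "f \<in> hom C x y \<Longrightarrow> g \<in> hom C y z \<Longrightarrow> g \<cdot> f \<in> hom C x z"
    and Comp_Id: "f \<in> hom C x y \<Longrightarrow> f \<cdot> Id C x = f"
    and Id_Comp: "f \<in> hom C x y \<Longrightarrow> Id C y \<cdot> f = f"
    and Comp_assoc: "f \<in> hom C w x \<Longrightarrow> g \<in> hom C x y \<Longrightarrow> h \<in> hom C y z \<Longrightarrow>
      (h \<cdot> g) \<cdot> f = h \<cdot> (g \<cdot> f)"

definition is_iso :: "('o, 'm) category \<Rightarrow> 'm \<Rightarrow> bool" where
  "is_iso C f \<longleftrightarrow> f \<in> Arr C \<and>
     (\<exists>g \<in> hom C (Cod C f) (Dom C f).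
        g \<cdot>\<^bsub>C\<^esub> f = Id C (Dom C f) \<and> f \<cdot>\<^bsub>C\<^esub> g = Id C (Cod C f))"

record ('o1, 'm1, 'o2, 'm2) functor_maps =
  OMap :: "'o1 \<Rightarrow> 'o2"
  AMap :: "'m1 \<Rightarrow> 'm2"

definition is_functor ::
  "('o1, 'm1) category \<Rightarrow> ('o2, 'm2) category \<Rightarrow> ('o1, 'm1, 'o2, 'm2) functor_maps \<Rightarrow> bool" where
  "is_functor C D F \<longleftrightarrow> category C \<and> category D \<and>
     (\<forall>x \<in> Obj C. OMap F x \<in> Obj D) \<and>
     (\<forall>f \<in> Arr C. AMap F f \<in> hom D (OMap F (Dom C f)) (OMap F (Cod C f))) \<and>
     (\<forall>x \<in> Obj C. AMap F (Id C x) = Id D (OMap F x)) \<and>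
     (\<forall>f \<in> Arr C. \<forall>g \<in> Arr C. Cod C f = Dom C g \<longrightarrow>
        AMap F (g \<cdot>\<^bsub>C\<^esub> f) = AMap F g \<cdot>\<^bsub>D\<^esub> AMap F f)"

definition id_functor :: "('o, 'm, 'o, 'm) functor_maps" where
  "id_functor = \<lparr>OMap = (\<lambda>x. x), AMap = (\<lambda>f. f)\<rparr>"

definition comp_functor ::
  "('o2, 'm2, 'o3, 'm3) functor_maps \<Rightarrow> ('o1, 'm1, 'o2, 'm2) functor_maps \<Rightarrow>
   ('o1, 'm1, 'o3, 'm3) functor_maps" where
  "comp_functor G F = \<lparr>OMap = (\<lambda>x. OMap G (OMap F x)), AMap = (\<lambda>f. AMap G (AMap F f))\<rparr>"

definition faithful ::
  "('o1, 'm1) category \<Rightarrow> ('o2, 'm2) category \<Rightarrow> ('o1, 'm1, 'o2, 'm2) functor_maps \<Rightarrow> bool" where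
  "faithful C D F \<longleftrightarrow> (\<forall>x \<in> Obj C. \<forall>y \<in> Obj C. inj_on (AMap F) (hom C x y))"

definition conservative ::
  "('o1, 'm1) category \<Rightarrow> ('o2, 'm2) category \<Rightarrow> ('o1, 'm1, 'o2, 'm2) functor_maps \<Rightarrow> bool" where
  "conservative C D F \<longleftrightarrow> (\<forall>f \<in> Arr C. is_iso D (AMap F f) \<longrightarrow> is_iso C f)"

definition nat_trans ::
  "('o1, 'm1) category \<Rightarrow> ('o2, 'm2) category \<Rightarrow> ('o1, 'm1, 'o2, 'm2) functor_maps \<Rightarrow>
   ('o1, 'm1, 'o2, 'm2) functor_maps \<Rightarrow> ('o1 \<Rightarrow> 'm2) \<Rightarrow> bool" where
  "nat_trans C D F G t \<longleftrightarrow> is_functor C D F \<and> is_functor C D G \<and>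
     (\<forall>x \<in> Obj C. t x \<in> hom D (OMap F x) (OMap G x)) \<and>
     (\<forall>f \<in> Arr C. t (Cod C f) \<cdot>\<^bsub>D\<^esub> AMap F f = AMap G f \<cdot>\<^bsub>D\<^esub> t (Dom C f))"

definition nat_iso ::
  "('o1, 'm1) category \<Rightarrow> ('o2, 'm2) category \<Rightarrow> ('o1, 'm1, 'o2, 'm2) functor_maps \<Rightarrow>
   ('o1, 'm1, 'o2, 'm2) functor_maps \<Rightarrow> ('o1 \<Rightarrow> 'm2) \<Rightarrow> bool" where
  "nat_iso C D F G t \<longleftrightarrow> nat_trans C D F G t \<and> (\<forall>x \<in> Obj C. is_iso D (t x))"

definition equivalence_of_categories ::
  "('o1, 'm1) category \<Rightarrow> ('o2, 'm2) category \<Rightarrow> ('o1, 'm1, 'o2, 'm2) functor_maps \<Rightarrow> bool" where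
  "equivalence_of_categories C D F \<longleftrightarrow> is_functor C D F \<and>
     (\<exists>G. is_functor D C G \<and>
        (\<exists>t. nat_iso C C id_functor (comp_functor G F) t) \<and>
        (\<exists>t. nat_iso D D (comp_functor F G) id_functor t))"

definition left_adjoint_with_unit ::
  "('oa, 'ma) category \<Rightarrow> ('ob, 'mb) category \<Rightarrow> ('oa, 'ma, 'ob, 'mb) functor_maps \<Rightarrow>
   ('ob, 'mb, 'oa, 'ma) functor_maps \<Rightarrow> ('oa \<Rightarrow> 'ma) \<Rightarrow> bool" where
  "left_adjoint_with_unit A B F U \<eta> \<longleftrightarrow>
     is_functor A B F \<and> is_functor B A U \<and>
     nat_trans A A id_functor (comp_functor U F) \<eta> \<and>
     (\<exists>\<epsilon>. nat_trans B B (comp_functor F U) id_functor \<epsilon> \<and>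
        (\<forall>X \<in> Obj A. \<epsilon> (OMap F X) \<cdot>\<^bsub>B\<^esub> AMap F (\<eta> X) = Id B (OMap F X)) \<and>
        (\<forall>Y \<in> Obj B. AMap U (\<epsilon> Y) \<cdot>\<^bsub>A\<^esub> \<eta> (OMap U Y) = Id A (OMap U Y)))"


section \<open>Limits and colimits\<close>

definition is_initial :: "('o, 'm) category \<Rightarrow> 'o \<Rightarrow> bool" where
  "is_initial C z \<longleftrightarrow> z \<in> Obj C \<and> (\<forall>x \<in> Obj C. \<exists>!f. f \<in> hom C z x)"

definition is_terminal :: "('o, 'm) category \<Rightarrow> 'o \<Rightarrow> bool" where
  "is_terminal C z \<longleftrightarrow> z \<in> Obj C \<and> (\<forall>x \<in> Obj C. \<exists>!f. f \<in> hom C x z)"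

definition is_zero_object :: "('o, 'm) category \<Rightarrow> 'o \<Rightarrow> bool" where
  "is_zero_object C z \<longleftrightarrow> is_initial C z \<and> is_terminal C z"

definition pointed :: "('o, 'm) category \<Rightarrow> bool" where
  "pointed C \<longleftrightarrow> (\<exists>z. is_zero_object C z)"

definition from_zero :: "('o, 'm) category \<Rightarrow> 'o \<Rightarrow> 'o \<Rightarrow> 'm" where
  "from_zero C z x = (THE f. f \<in> hom C z x)"

definition to_zero :: "('o, 'm) category \<Rightarrow> 'o \<Rightarrow> 'o \<Rightarrow> 'm" where
  "to_zero C z x = (THE f. f \<in> hom C x z)"

definition zero_arrow :: "('o, 'm) category \<Rightarrow> 'o \<Rightarrow> 'o \<Rightarrow> 'o \<Rightarrow> 'm" where
  "zero_arrow C z x y = from_zero C z y \<cdot>\<^bsub>C\<^esub> to_zero C z x"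

definition is_cone ::
  "('j, 'k) category \<Rightarrow> ('o, 'm) category \<Rightarrow> ('j, 'k, 'o, 'm) functor_maps \<Rightarrow>
   'o \<Rightarrow> ('j \<Rightarrow> 'm) \<Rightarrow> bool" where
  "is_cone J C D x c \<longleftrightarrow> x \<in> Obj C \<and>
     (\<forall>j \<in> Obj J. c j \<in> hom C x (OMap D j)) \<and>
     (\<forall>m \<in> Arr J. AMap D m \<cdot>\<^bsub>C\<^esub> c (Dom J m) = c (Cod J m))"

definition is_limit ::
  "('j, 'k) category \<Rightarrow> ('o, 'm) category \<Rightarrow> ('j, 'k, 'o, 'm) functor_maps \<Rightarrow>
   'o \<Rightarrow> ('j \<Rightarrow> 'm) \<Rightarrow> bool" where
  "is_limit J C D x c \<longleftrightarrow> is_cone J C D x c \<and>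
     (\<forall>y d. is_cone J C D y d \<longrightarrow>
        (\<exists>!u. u \<in> hom C y x \<and> (\<forall>j \<in> Obj J. c j \<cdot>\<^bsub>C\<^esub> u = d j)))"

text \<open>Every finite category is isomorphic to one whose objects and arrows are natural numbers,
  so ranging over index categories of type \<^typ>\<open>(nat, nat) category\<close> loses nothing.\<close>

definition finitely_complete :: "('o, 'm) category \<Rightarrow> bool" where
  "finitely_complete C \<longleftrightarrow>
     (\<forall>(J :: (nat, nat) category) D.
        finite (Obj J) \<and> finite (Arr J) \<and> is_functor J C D \<longrightarrow> (\<exists>x c. is_limit J C D x c))"

text \<open>\<open>is_pullback C f g a b\<close>: the arrows \<open>a\<close> and \<open>b\<close> are the projections of a pullback of the
  cospan \<open>f\<close>, \<open>g\<close>, so that \<open>f \<cdot> a = g \<cdot> b\<close> and \<open>b\<close> is the pullback of \<open>f\<close> along \<open>g\<close>.\<close>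

definition is_pullback :: "('o, 'm) category \<Rightarrow> 'm \<Rightarrow> 'm \<Rightarrow> 'm \<Rightarrow> 'm \<Rightarrow> bool" where
  "is_pullback C f g a b \<longleftrightarrow>
     f \<in> Arr C \<and> g \<in> Arr C \<and> a \<in> Arr C \<and> b \<in> Arr C \<and>
     Cod C f = Cod C g \<and> Dom C a = Dom C b \<and> Cod C a = Dom C f \<and> Cod C b = Dom C g \<and>
     f \<cdot>\<^bsub>C\<^esub> a = g \<cdot>\<^bsub>C\<^esub> b \<and>
     (\<forall>w. \<forall>x \<in> hom C w (Dom C f). \<forall>y \<in> hom C w (Dom C g). f \<cdot>\<^bsub>C\<^esub> x = g \<cdot>\<^bsub>C\<^esub> y \<longrightarrow>
        (\<exists>!u. u \<in> hom C w (Dom C a) \<and> a \<cdot>\<^bsub>C\<^esub> u = x \<and> b \<cdot>\<^bsub>C\<^esub> u = y))"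

definition has_pullbacks :: "('o, 'm) category \<Rightarrow> bool" where
  "has_pullbacks C \<longleftrightarrow>
     (\<forall>f \<in> Arr C. \<forall>g \<in> Arr C. Cod C f = Cod C g \<longrightarrow> (\<exists>a b. is_pullback C f g a b))"

definition pullback_lift :: "('o, 'm) category \<Rightarrow> 'm \<times> 'm \<Rightarrow> 'm \<Rightarrow> 'm \<Rightarrow> 'm" where
  "pullback_lift C ab x y =
     (THE u. u \<in> hom C (Dom C x) (Dom C (fst ab)) \<and> fst ab \<cdot>\<^bsub>C\<^esub> u = x \<and> snd ab \<cdot>\<^bsub>C\<^esub> u = y)"

definition is_coequalizer :: "('o, 'm) category \<Rightarrow> 'm \<Rightarrow> 'm \<Rightarrow> 'm \<Rightarrow> bool" where
  "is_coequalizer C f g e \<longleftrightarrow>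
     f \<in> Arr C \<and> g \<in> Arr C \<and> e \<in> Arr C \<and>
     Dom C f = Dom C g \<and> Cod C f = Cod C g \<and> Dom C e = Cod C f \<and>
     e \<cdot>\<^bsub>C\<^esub> f = e \<cdot>\<^bsub>C\<^esub> g \<and>
     (\<forall>w. \<forall>h \<in> hom C (Cod C f) w. h \<cdot>\<^bsub>C\<^esub> f = h \<cdot>\<^bsub>C\<^esub> g \<longrightarrow>
        (\<exists>!u. u \<in> hom C (Cod C e) w \<and> u \<cdot>\<^bsub>C\<^esub> e = h))"

definition regular_epi :: "('o, 'm) category \<Rightarrow> 'm \<Rightarrow> bool" where
  "regular_epi C e \<longleftrightarrow> (\<exists>f g. is_coequalizer C f g e)"

definition regular :: "('o, 'm) category \<Rightarrow> bool" where
  "regular C \<longleftrightarrow> finitely_complete C \<and>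
     (\<forall>e g a b. regular_epi C e \<and> is_pullback C e g a b \<longrightarrow> regular_epi C b) \<and>
     (\<forall>f a b. is_pullback C f f a b \<longrightarrow> (\<exists>e. is_coequalizer C a b e))"


section \<open>Points and protomodularity\<close>

text \<open>An arrow of the category of points is stored as (source, underlying arrow, target), since the
  underlying arrow does not determine its source and target.\<close>

definition pt_obj :: "('o, 'm) category \<Rightarrow> 'o \<Rightarrow> ('o \<times> 'm \<times> 'm) set" where
  "pt_obj C J = {(B, p, s). B \<in> Obj C \<and> p \<in> hom C B J \<and> s \<in> hom C J B \<and> p \<cdot>\<^bsub>C\<^esub> s = Id C J}"

definition pt :: "('o, 'm) category \<Rightarrow> 'o \<Rightarrow>
    ('o \<times> 'm \<times> 'm, ('o \<times> 'm \<times> 'm) \<times> 'm \<times> ('o \<times> 'm \<times> 'm)) category" where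
  "pt C J = \<lparr>
     Obj = pt_obj C J,
     Arr = {((B', p', s'), f, (B, p, s)) | B' p' s' f B p s.
              (B', p', s') \<in> pt_obj C J \<and> (B, p, s) \<in> pt_obj C J \<and>
              f \<in> hom C B' B \<and> p \<cdot>\<^bsub>C\<^esub> f = p' \<and> f \<cdot>\<^bsub>C\<^esub> s' = s},
     Dom = (\<lambda>(X, f, Y). X),
     Cod = (\<lambda>(X, f, Y). Y),
     Id = (\<lambda>(B, p, s). ((B, p, s), Id C B, (B, p, s))),
     Comp = (\<lambda>(Y', g, Z) (X, f, Y). (X, g \<cdot>\<^bsub>C\<^esub> f, Z))\<rparr>"

definition pullback_choice :: "('o, 'm) category \<Rightarrow> ('m \<Rightarrow> 'm \<Rightarrow> 'm \<times> 'm) \<Rightarrow> bool" where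
  "pullback_choice C P \<longleftrightarrow>
     (\<forall>f \<in> Arr C. \<forall>g \<in> Arr C. Cod C f = Cod C g \<longrightarrow>
        is_pullback C f g (fst (P f g)) (snd (P f g)))"

text \<open>The functor \<open>g\<^sup>*\<close> formed with a choice \<open>P\<close> of pullbacks: the point \<open>(B, p, s)\<close> over the
  codomain of \<open>g\<close> is sent to the pullback of \<open>p\<close> along \<open>g\<close>, with the section induced by \<open>s \<cdot> g\<close>
  and the identity.\<close>

definition pt_pullback_obj ::
  "('o, 'm) category \<Rightarrow> ('m \<Rightarrow> 'm \<Rightarrow> 'm \<times> 'm) \<Rightarrow> 'm \<Rightarrow> 'o \<times> 'm \<times> 'm \<Rightarrow> 'o \<times> 'm \<times> 'm" where
  "pt_pullback_obj C P g = (\<lambda>(B, p, s).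
     (Dom C (snd (P p g)), snd (P p g), pullback_lift C (P p g) (s \<cdot>\<^bsub>C\<^esub> g) (Id C (Dom C g))))"

definition pt_pullback ::
  "('o, 'm) category \<Rightarrow> ('m \<Rightarrow> 'm \<Rightarrow> 'm \<times> 'm) \<Rightarrow> 'm \<Rightarrow>
   ('o \<times> 'm \<times> 'm, ('o \<times> 'm \<times> 'm) \<times> 'm \<times> ('o \<times> 'm \<times> 'm),
    'o \<times> 'm \<times> 'm, ('o \<times> 'm \<times> 'm) \<times> 'm \<times> ('o \<times> 'm \<times> 'm)) functor_maps" where
  "pt_pullback C P g = \<lparr>
     OMap = pt_pullback_obj C P g,
     AMap = (\<lambda>((B', p', s'), f, (B, p, s)).
       (pt_pullback_obj C P g (B', p', s'),
        pullback_lift C (P p g) (f \<cdot>\<^bsub>C\<^esub> fst (P p' g)) (snd (P p' g)),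
        pt_pullback_obj C P g (B, p, s)))\<rparr>"

text \<open>Different choices of pullbacks give isomorphic functors \<open>g\<^sup>*\<close>, so quantifying over all choices
  is the same as fixing one.\<close>

definition protomodular :: "('o, 'm) category \<Rightarrow> bool" where
  "protomodular C \<longleftrightarrow> has_pullbacks C \<and>
     (\<forall>P. pullback_choice C P \<longrightarrow>
        (\<forall>g \<in> Arr C. conservative (pt C (Cod C g)) (pt C (Dom C g)) (pt_pullback C P g)))"

definition homological :: "('o, 'm) category \<Rightarrow> bool" where
  "homological C \<longleftrightarrow> category C \<and> pointed C \<and> regular C \<and> protomodular C"


section \<open>Kernels, slices and the kernel functor\<close>

definition is_kernel :: "('o, 'm) category \<Rightarrow> 'o \<Rightarrow> 'm \<Rightarrow> 'm \<Rightarrow> bool" where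
  "is_kernel C z p k \<longleftrightarrow>
     is_pullback C p (from_zero C z (Cod C p)) k (to_zero C z (Dom C k))"

definition kernel_choice :: "('o, 'm) category \<Rightarrow> 'o \<Rightarrow> ('m \<Rightarrow> 'm) \<Rightarrow> bool" where
  "kernel_choice C z ker \<longleftrightarrow> (\<forall>p \<in> Arr C. is_kernel C z p (ker p))"

text \<open>The object \<open>f : B \<rightarrow> I\<close> of the slice category is represented by the arrow \<open>f\<close>, whose domain
  is \<open>B\<close>; an arrow from \<open>f\<close> to \<open>g\<close> is a triple \<open>(f, h, g)\<close> with \<open>g \<cdot> h = f\<close>.\<close>

definition slice :: "('o, 'm) category \<Rightarrow> 'o \<Rightarrow> ('m, 'm \<times> 'm \<times> 'm) category" where
  "slice C I = \<lparr>
     Obj = {f \<in> Arr C. Cod C f = I},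
     Arr = {(f, h, g). f \<in> Arr C \<and> Cod C f = I \<and> g \<in> Arr C \<and> Cod C g = I \<and>
              h \<in> hom C (Dom C f) (Dom C g) \<and> g \<cdot>\<^bsub>C\<^esub> h = f},
     Dom = (\<lambda>(f, h, g). f),
     Cod = (\<lambda>(f, h, g). g),
     Id = (\<lambda>f. (f, Id C (Dom C f), f)),
     Comp = (\<lambda>(g', k, l) (f, h, g). (f, k \<cdot>\<^bsub>C\<^esub> h, l))\<rparr>"

definition kernel_functor ::
  "('ob, 'mb) category \<Rightarrow> ('oa, 'ma) category \<Rightarrow> ('ob, 'mb, 'oa, 'ma) functor_maps \<Rightarrow>
   ('ma \<Rightarrow> 'ma) \<Rightarrow> ('mb, 'mb \<times> 'mb \<times> 'mb, 'oa, 'ma) functor_maps" where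
  "kernel_functor B A U ker = \<lparr>
     OMap = (\<lambda>f. Dom A (ker (AMap U f))),
     AMap = (\<lambda>(f, h, g).
       THE u. u \<in> hom A (Dom A (ker (AMap U f))) (Dom A (ker (AMap U g))) \<and>
              ker (AMap U g) \<cdot>\<^bsub>A\<^esub> u = AMap U h \<cdot>\<^bsub>A\<^esub> ker (AMap U f))\<rparr>"

definition augmentation ::
  "('oa, 'ma) category \<Rightarrow> ('ob, 'mb) category \<Rightarrow> ('oa, 'ma, 'ob, 'mb) functor_maps \<Rightarrow>
   ('ob, 'mb, 'oa, 'ma) functor_maps \<Rightarrow> ('oa \<Rightarrow> 'ma) \<Rightarrow> 'oa \<Rightarrow> 'oa \<Rightarrow> 'mb" where
  "augmentation A B F U \<eta> z X =
     (THE p. p \<in> hom B (OMap F X) (OMap F z) \<and>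
        AMap U p \<cdot>\<^bsub>A\<^esub> \<eta> X = zero_arrow A z X (OMap U (OMap F z)))"


section \<open>Well-definedness\<close>

lemma category_pt:
  assumes "category C" shows "category (pt C J)"
proof -
  interpret category C by fact
  have pt_Arr: "\<exists>B' p' s' f B p s. m = ((B', p', s'), f, (B, p, s)) \<and> X = (B', p', s') \<and> Y = (B, p, s) \<and>
      X \<in> pt_obj C J \<and> Y \<in> pt_obj C J \<and> p' \<in> hom C B' J \<and> p \<in> hom C B J \<and> s' \<in> hom C J B' \<and>
      f \<in> hom C B' B \<and> p \<cdot>\<^bsub>C\<^esub> f = p' \<and> f \<cdot>\<^bsub>C\<^esub> s' = s"
    if "m \<in> hom (pt C J) X Y" for m X Y
    using that unfolding hom_def[of "pt C J"] unfolding pt_def pt_obj_def by auto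
  show ?thesis
  proof (rule category.intro, goal_cases)
    case (1 m) then show ?case unfolding pt_def by auto
  next
    case (2 m) then show ?case unfolding pt_def by auto
  next
    case (3 X)
    obtain B p s where X: "X = (B, p, s)" by (cases X)
    have "B \<in> Obj C" "p \<in> hom C B J" "s \<in> hom C J B" "X \<in> pt_obj C J"
      using 3 X unfolding pt_def pt_obj_def by auto
    then show ?case
      using Id_hom[of B] Comp_Id[of p B J] Id_Comp[of s J B] X
      unfolding hom_def[of "pt C J"] unfolding pt_def by simp
  next
    case (4 m X Y n Z)
    from pt_Arr[OF 4(1)] obtain B' p' s' f B p s where m: "m = ((B', p', s'), f, (B, p, s))"
      "X = (B', p', s')" "Y = (B, p, s)" "X \<in> pt_obj C J" "p' \<in> hom C B' J" "s' \<in> hom C J B'"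
      "f \<in> hom C B' B" "p \<cdot>\<^bsub>C\<^esub> f = p'" "f \<cdot>\<^bsub>C\<^esub> s' = s" by blast
    from pt_Arr[OF 4(2)] m(3) obtain g B2 p2 s2 where n: "n = ((B, p, s), g, (B2, p2, s2))"
      "Z = (B2, p2, s2)" "Z \<in> pt_obj C J" "p2 \<in> hom C B2 J"
      "g \<in> hom C B B2" "p2 \<cdot>\<^bsub>C\<^esub> g = p" "g \<cdot>\<^bsub>C\<^esub> s = s2" by blast
    show ?case
      using Comp_hom[OF m(7) n(5)] Comp_assoc[OF m(6,7) n(5)] Comp_assoc[OF m(7) n(5,4)]
        m(4,8,9) n(3,6,7)
      unfolding m(1-3) n(1,2) hom_def[of "pt C J"] unfolding pt_def by simp
  next
    case (5 m X Y)
    from pt_Arr[OF 5] Comp_Id show ?case unfolding pt_def by auto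
  next
    case (6 m X Y)
    from pt_Arr[OF 6] Id_Comp show ?case unfolding pt_def by auto
  next
    case (7 m W X n Y k Z)
    from pt_Arr[OF 7(1)] obtain p f q B1 B2 where "m = (p, f, q)" "f \<in> hom C B1 B2" "q = X" "fst X = B2"
      by auto
    moreover from pt_Arr[OF 7(2)] obtain p g q B3 where "n = (p, g, q)" "g \<in> hom C (fst X) B3" "fst Y = B3"
      by auto
    moreover from pt_Arr[OF 7(3)] obtain p h q B4 where "k = (p, h, q)" "h \<in> hom C (fst Y) B4"
      by auto
    ultimately show ?case using Comp_assoc unfolding pt_def by simp
  qed
qed

lemma category_slice:
  assumes "category C" shows "category (slice C I)"
proof -
  interpret category C by fact
  have slice_Arr: "\<exists>h. m = (f, h, g) \<and> f \<in> Arr C \<and> Cod C f = I \<and> g \<in> hom C (Dom C g) I \<and>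
      h \<in> hom C (Dom C f) (Dom C g) \<and> g \<cdot>\<^bsub>C\<^esub> h = f"
    if "m \<in> hom (slice C I) f g" for m f g
    using that unfolding hom_def slice_def by auto
  show ?thesis
  proof (rule category.intro, goal_cases)
    case (1 m) then show ?case unfolding slice_def by auto
  next
    case (2 m) then show ?case unfolding slice_def by auto
  next
    case (3 f)
    then have "f \<in> hom C (Dom C f) I" "Dom C f \<in> Obj C"
      using Dom_Obj unfolding slice_def hom_def by auto
    then show ?case using 3 Id_hom[of "Dom C f"] Comp_Id[of f "Dom C f" I]
      unfolding hom_def[of "slice C I"] unfolding slice_def by simp
  next
    case (4 m f g n k)
    from slice_Arr[OF 4(1)] obtain u where m: "m = (f, u, g)" "f \<in> Arr C" "Cod C f = I"
      "u \<in> hom C (Dom C f) (Dom C g)" "g \<cdot>\<^bsub>C\<^esub> u = f" by blast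
    from slice_Arr[OF 4(2)] obtain v where n: "n = (g, v, k)" "k \<in> hom C (Dom C k) I"
      "v \<in> hom C (Dom C g) (Dom C k)" "k \<cdot>\<^bsub>C\<^esub> v = g" by blast
    have "k \<in> Arr C" "Cod C k = I" using n(2) unfolding hom_def by auto
    then show ?case
      using Comp_hom[OF m(4) n(3)] Comp_assoc[OF m(4) n(3,2)] m n(4)
      unfolding m(1) n(1) hom_def[of "slice C I"] unfolding slice_def by simp
  next
    case (5 m f g)
    from slice_Arr[OF 5] Comp_Id show ?case unfolding slice_def by auto
  next
    case (6 m f g)
    from slice_Arr[OF 6] Id_Comp show ?case unfolding slice_def by auto
  next
    case (7 m f g n h k l)
    obtain u v w where "m = (f, u, g)" "n = (g, v, h)" "k = (h, w, l)"
      and uvw: "u \<in> hom C (Dom C f) (Dom C g)" "v \<in> hom C (Dom C g) (Dom C h)"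
        "w \<in> hom C (Dom C h) (Dom C l)"
      using slice_Arr[OF 7(1)] slice_Arr[OF 7(2)] slice_Arr[OF 7(3)] by blast
    then show ?case using Comp_assoc[OF uvw] unfolding slice_def by simp
  qed
qed

lemma left_adjoint_universal:
  assumes adj: "left_adjoint_with_unit A B F U \<eta>" and X: "X \<in> Obj A" and Y: "Y \<in> Obj B"
    and h: "h \<in> hom A X (OMap U Y)"
  shows "\<exists>!g. g \<in> hom B (OMap F X) Y \<and> AMap U g \<cdot>\<^bsub>A\<^esub> \<eta> X = h"
proof -
  from adj obtain \<epsilon> where FF: "is_functor A B F" and FU: "is_functor B A U"
    and ne: "nat_trans A A id_functor (comp_functor U F) \<eta>"
    and nep: "nat_trans B B (comp_functor F U) id_functor \<epsilon>"
    and t1: "\<And>X. X \<in> Obj A \<Longrightarrow> \<epsilon> (OMap F X) \<cdot>\<^bsub>B\<^esub> AMap F (\<eta> X) = Id B (OMap F X)"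
    and t2: "\<And>Y. Y \<in> Obj B \<Longrightarrow> AMap U (\<epsilon> Y) \<cdot>\<^bsub>A\<^esub> \<eta> (OMap U Y) = Id A (OMap U Y)"
    unfolding left_adjoint_with_unit_def by blast
  interpret A: category A using FF unfolding is_functor_def by blast
  interpret B: category B using FF unfolding is_functor_def by blast
  have Fo: "\<And>X. X \<in> Obj A \<Longrightarrow> OMap F X \<in> Obj B" and Uo: "\<And>X. X \<in> Obj B \<Longrightarrow> OMap U X \<in> Obj A"
    using FF FU unfolding is_functor_def by blast+
  have Fh: "\<And>f x y. f \<in> hom A x y \<Longrightarrow> AMap F f \<in> hom B (OMap F x) (OMap F y)"
   and Uh: "\<And>f x y. f \<in> hom B x y \<Longrightarrow> AMap U f \<in> hom A (OMap U x) (OMap U y)"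
    using FF FU unfolding is_functor_def hom_def by blast+
  have Fc: "\<And>f g x y z. f \<in> hom A x y \<Longrightarrow> g \<in> hom A y z \<Longrightarrow> AMap F (g \<cdot>\<^bsub>A\<^esub> f) = AMap F g \<cdot>\<^bsub>B\<^esub> AMap F f"
   and Uc: "\<And>f g x y z. f \<in> hom B x y \<Longrightarrow> g \<in> hom B y z \<Longrightarrow> AMap U (g \<cdot>\<^bsub>B\<^esub> f) = AMap U g \<cdot>\<^bsub>A\<^esub> AMap U f"
    using FF FU unfolding is_functor_def hom_def by force+
  have eh: "\<And>X. X \<in> Obj A \<Longrightarrow> \<eta> X \<in> hom A X (OMap U (OMap F X))"
    and en: "\<And>f x y. f \<in> hom A x y \<Longrightarrow> \<eta> y \<cdot>\<^bsub>A\<^esub> f = AMap U (AMap F f) \<cdot>\<^bsub>A\<^esub> \<eta> x"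
    using ne unfolding nat_trans_def id_functor_def comp_functor_def hom_def by auto
  have ph: "\<And>X. X \<in> Obj B \<Longrightarrow> \<epsilon> X \<in> hom B (OMap F (OMap U X)) X"
    and pn: "\<And>f x y. f \<in> hom B x y \<Longrightarrow> \<epsilon> y \<cdot>\<^bsub>B\<^esub> AMap F (AMap U f) = f \<cdot>\<^bsub>B\<^esub> \<epsilon> x"
    using nep unfolding nat_trans_def id_functor_def comp_functor_def hom_def by auto
  let ?g = "\<epsilon> Y \<cdot>\<^bsub>B\<^esub> AMap F h"
  show ?thesis
  proof (rule ex1I[of _ ?g], intro conjI)
    show "?g \<in> hom B (OMap F X) Y" using B.Comp_hom[OF Fh[OF h] ph[OF Y]] .
    show "AMap U ?g \<cdot>\<^bsub>A\<^esub> \<eta> X = h"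
      using Uc[OF Fh[OF h] ph[OF Y]] A.Comp_assoc[OF eh[OF X] Uh[OF Fh[OF h]] Uh[OF ph[OF Y]]]
        en[OF h] A.Comp_assoc[OF h eh[OF Uo[OF Y]] Uh[OF ph[OF Y]]] t2[OF Y] A.Id_Comp[OF h] by simp
  next
    fix g assume g: "g \<in> hom B (OMap F X) Y \<and> AMap U g \<cdot>\<^bsub>A\<^esub> \<eta> X = h"
    then have g1: "g \<in> hom B (OMap F X) Y" and g2: "h = AMap U g \<cdot>\<^bsub>A\<^esub> \<eta> X" by auto
    have "?g = \<epsilon> Y \<cdot>\<^bsub>B\<^esub> (AMap F (AMap U g) \<cdot>\<^bsub>B\<^esub> AMap F (\<eta> X))"
      unfolding g2 using Fc[OF eh[OF X] Uh[OF g1]] by simp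
    also have "\<dots> = (g \<cdot>\<^bsub>B\<^esub> \<epsilon> (OMap F X)) \<cdot>\<^bsub>B\<^esub> AMap F (\<eta> X)"
      using B.Comp_assoc[OF Fh[OF eh[OF X]] Fh[OF Uh[OF g1]] ph[OF Y]] pn[OF g1] by simp
    also have "\<dots> = g"
      using B.Comp_assoc[OF Fh[OF eh[OF X]] ph[OF Fo[OF X]] g1] t1[OF X] B.Comp_Id[OF g1] by simp
    finally show "g = ?g" by simp
  qed
qed

lemma is_initial_left_adjoint_zero:
  assumes adj: "left_adjoint_with_unit A B F U \<eta>" and z: "is_zero_object A z"
  shows "is_initial B (OMap F z)"
proof -
  have zi: "z \<in> Obj A" "\<And>x. x \<in> Obj A \<Longrightarrow> \<exists>!f. f \<in> hom A z x"
    using z unfolding is_zero_object_def is_initial_def by auto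
  have FF: "is_functor A B F" and FU: "is_functor B A U"
    and ne: "nat_trans A A id_functor (comp_functor U F) \<eta>"
    using adj unfolding left_adjoint_with_unit_def by blast+
  interpret A: category A using FF unfolding is_functor_def by blast
  have o: "OMap F z \<in> Obj B" using FF zi(1) unfolding is_functor_def by blast
  show ?thesis unfolding is_initial_def
  proof (intro conjI ballI o)
    fix Y assume Y: "Y \<in> Obj B"
    then have "OMap U Y \<in> Obj A" using FU unfolding is_functor_def by blast
    then obtain f where f: "f \<in> hom A z (OMap U Y)" "\<And>f'. f' \<in> hom A z (OMap U Y) \<Longrightarrow> f' = f"
      using zi(2) by blast
    have "AMap U g \<cdot>\<^bsub>A\<^esub> \<eta> z = f" if "g \<in> hom B (OMap F z) Y" for g
    proof (rule f(2), rule A.Comp_hom)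
      show "\<eta> z \<in> hom A z (OMap U (OMap F z))"
        using ne zi(1) unfolding nat_trans_def id_functor_def comp_functor_def by auto
      show "AMap U g \<in> hom A (OMap U (OMap F z)) (OMap U Y)"
        using FU that unfolding is_functor_def by (auto simp: hom_def)
    qed
    then show "\<exists>!g. g \<in> hom B (OMap F z) Y"
      using left_adjoint_universal[OF adj zi(1) Y f(1)] by metis
  qed
qed

lemma zero_arrow_hom:
  assumes "category A" "is_zero_object A z" "x \<in> Obj A" "y \<in> Obj A"
  shows "zero_arrow A z x y \<in> hom A x y"
proof -
  interpret category A by fact
  have "from_zero A z y \<in> hom A z y" "to_zero A z x \<in> hom A x z"
    using assms(2-4) unfolding from_zero_def to_zero_def is_zero_object_def is_initial_def is_terminal_def
    by (metis theI')+
  then show ?thesis unfolding zero_arrow_def by (rule Comp_hom[rotated])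
qed

lemma augmentation_unique:
  assumes adj: "left_adjoint_with_unit A B F U \<eta>" and z: "is_zero_object A z" and X: "X \<in> Obj A"
  shows "\<exists>!p. p \<in> hom B (OMap F X) (OMap F z) \<and>
        AMap U p \<cdot>\<^bsub>A\<^esub> \<eta> X = zero_arrow A z X (OMap U (OMap F z))"
proof (rule left_adjoint_universal[OF adj X])
  show I: "OMap F z \<in> Obj B" using is_initial_left_adjoint_zero[OF adj z] unfolding is_initial_def by blast
  have FU: "is_functor B A U" using adj unfolding left_adjoint_with_unit_def by blast
  have "category A" "OMap U (OMap F z) \<in> Obj A" using FU I unfolding is_functor_def by blast+
  then show "zero_arrow A z X (OMap U (OMap F z)) \<in> hom A X (OMap U (OMap F z))"
    using zero_arrow_hom z X by metis
qed

lemma pullback_lift_props: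
  assumes "is_pullback C f g (fst ab) (snd ab)" "x \<in> hom C w (Dom C f)" "y \<in> hom C w (Dom C g)"
    "f \<cdot>\<^bsub>C\<^esub> x = g \<cdot>\<^bsub>C\<^esub> y"
  shows "pullback_lift C ab x y \<in> hom C w (Dom C (snd ab))"
    "fst ab \<cdot>\<^bsub>C\<^esub> pullback_lift C ab x y = x" "snd ab \<cdot>\<^bsub>C\<^esub> pullback_lift C ab x y = y"
    "\<And>u. u \<in> hom C w (Dom C (snd ab)) \<Longrightarrow> fst ab \<cdot>\<^bsub>C\<^esub> u = x \<Longrightarrow> snd ab \<cdot>\<^bsub>C\<^esub> u = y \<Longrightarrow> u = pullback_lift C ab x y"
proof -
  have w: "Dom C x = w" using assms(2) unfolding hom_def by simp
  have e: "\<exists>!u. u \<in> hom C w (Dom C (fst ab)) \<and> fst ab \<cdot>\<^bsub>C\<^esub> u = x \<and> snd ab \<cdot>\<^bsub>C\<^esub> u = y"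
    and d: "Dom C (fst ab) = Dom C (snd ab)"
    using assms unfolding is_pullback_def by blast+
  from theI'[OF e] show "pullback_lift C ab x y \<in> hom C w (Dom C (snd ab))"
    "fst ab \<cdot>\<^bsub>C\<^esub> pullback_lift C ab x y = x" "snd ab \<cdot>\<^bsub>C\<^esub> pullback_lift C ab x y = y"
    unfolding pullback_lift_def w d by auto
  show "u = pullback_lift C ab x y"
    if "u \<in> hom C w (Dom C (snd ab))" "fst ab \<cdot>\<^bsub>C\<^esub> u = x" "snd ab \<cdot>\<^bsub>C\<^esub> u = y" for u
    unfolding pullback_lift_def w using the1_equality[OF e, of u] that d by simp
qed

lemma functor_pt_pullback:
  assumes "category C" and P: "pullback_choice C P" and g: "g \<in> hom C J' J"
  shows "is_functor (pt C J) (pt C J') (pt_pullback C P g)"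
proof -
  interpret category C by fact
  have gA: "g \<in> Arr C" "Dom C g = J'" "Cod C g = J" using g unfolding hom_def by auto
  have J': "J' \<in> Obj C" using Dom_Obj[OF gA(1)] gA by simp
  have pb: "is_pullback C p g (fst (P p g)) (snd (P p g))" if "p \<in> hom C B J" for p B
    using P that gA unfolding pullback_choice_def hom_def by auto
  have a: "fst (P p g) \<in> hom C (Dom C (snd (P p g))) B" "snd (P p g) \<in> hom C (Dom C (snd (P p g))) J'"
    "p \<cdot>\<^bsub>C\<^esub> fst (P p g) = g \<cdot>\<^bsub>C\<^esub> snd (P p g)"
     if "p \<in> hom C B J" for p B
    using pb[OF that] that gA unfolding is_pullback_def hom_def by auto
  have S: "s \<cdot>\<^bsub>C\<^esub> g \<in> hom C J' (Dom C p)" "Id C J' \<in> hom C J' (Dom C g)" "p \<cdot>\<^bsub>C\<^esub> (s \<cdot>\<^bsub>C\<^esub> g) = g \<cdot>\<^bsub>C\<^esub> Id C J'"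
    if "(B,p,s) \<in> pt_obj C J" for B p s
    using that Comp_hom[OF g, of s B] Comp_assoc[OF g, of s B p J] Id_Comp[OF g] Comp_Id[OF g] Id_hom[OF J'] gA(2)
    unfolding pt_obj_def hom_def by auto
  have ob: "pt_pullback_obj C P g X \<in> pt_obj C J'" if "X \<in> pt_obj C J" for X
  proof -
    obtain B p s where X: "X = (B,p,s)" by (cases X)
    have p: "p \<in> hom C B J" using that X unfolding pt_obj_def by auto
    note l = pullback_lift_props[OF pb[OF p] S[OF that[unfolded X]]]
    show ?thesis unfolding X pt_pullback_obj_def pt_obj_def gA using l(1,3) a[OF p] Dom_Obj
      by (auto simp: hom_def)
  qed
  have L: "f \<cdot>\<^bsub>C\<^esub> fst (P p' g) \<in> hom C (Dom C (snd (P p' g))) (Dom C p)"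
      "snd (P p' g) \<in> hom C (Dom C (snd (P p' g))) (Dom C g)"
      "p \<cdot>\<^bsub>C\<^esub> (f \<cdot>\<^bsub>C\<^esub> fst (P p' g)) = g \<cdot>\<^bsub>C\<^esub> snd (P p' g)"
    if "f \<in> hom C B' B" "p \<in> hom C B J" "p' \<in> hom C B' J" "p \<cdot>\<^bsub>C\<^esub> f = p'" for B p p' B' f
    using that a[OF that(3)] Comp_hom[OF a(1)[OF that(3)] that(1)] Comp_assoc[OF a(1)[OF that(3)] that(1,2)] gA
    by (auto simp: hom_def)
  have AM: "AMap (pt_pullback C P g) m \<in> Arr (pt C J')" if m: "m \<in> Arr (pt C J)" for m
  proof -
    from m obtain B' p' s' f B p s where me: "m = ((B',p',s'),f,(B,p,s))" and
      o: "(B', p', s') \<in> pt_obj C J" "(B, p, s) \<in> pt_obj C J" and f: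
              "f \<in> hom C B' B" "p \<cdot>\<^bsub>C\<^esub> f = p'" "f \<cdot>\<^bsub>C\<^esub> s' = s" unfolding pt_def by auto
    have p: "p \<in> hom C B J" "p' \<in> hom C B' J" "s \<in> hom C J B" "s' \<in> hom C J B'" using o unfolding pt_obj_def by auto
    note l = pullback_lift_props[OF pb[OF p(1)] L[OF f(1) p(1,2) f(2)]]
    note ls = pullback_lift_props[OF pb[OF p(1)] S[OF o(2)]]
    note ls' = pullback_lift_props[OF pb[OF p(2)] S[OF o(1)]]
    let ?u = "pullback_lift C (P p g) (f \<cdot>\<^bsub>C\<^esub> fst (P p' g)) (snd (P p' g))"
    let ?s' = "pullback_lift C (P p' g) (s' \<cdot>\<^bsub>C\<^esub> g) (Id C J')"
    have "?u \<cdot>\<^bsub>C\<^esub> ?s' = pullback_lift C (P p g) (s \<cdot>\<^bsub>C\<^esub> g) (Id C J')"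
    proof (rule ls(4))
      show "?u \<cdot>\<^bsub>C\<^esub> ?s' \<in> hom C J' (Dom C (snd (P p g)))" using Comp_hom[OF ls'(1) l(1)] .
      have "fst (P p g) \<cdot>\<^bsub>C\<^esub> (?u \<cdot>\<^bsub>C\<^esub> ?s') = f \<cdot>\<^bsub>C\<^esub> (s' \<cdot>\<^bsub>C\<^esub> g)"
        using Comp_assoc[OF ls'(1) l(1) a(1)[OF p(1)]] l(2) Comp_assoc[OF ls'(1) a(1)[OF p(2)] f(1)] ls'(2) by simp
      then show "fst (P p g) \<cdot>\<^bsub>C\<^esub> (?u \<cdot>\<^bsub>C\<^esub> ?s') = s \<cdot>\<^bsub>C\<^esub> g"
        using Comp_assoc[OF g p(4) f(1)] f(3) by simp
      show "snd (P p g) \<cdot>\<^bsub>C\<^esub> (?u \<cdot>\<^bsub>C\<^esub> ?s') = Id C J'"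
        using Comp_assoc[OF ls'(1) l(1) a(2)[OF p(1)]] l(3) ls'(3) by simp
    qed
    then show ?thesis using ob[OF o(1)] ob[OF o(2)] l(1,3)
      unfolding me pt_pullback_def pt_pullback_obj_def pt_def gA by auto
  qed
  show ?thesis unfolding is_functor_def
  proof (intro conjI ballI impI category_pt[OF assms(1)])
    fix X assume "X \<in> Obj (pt C J)" then show "OMap (pt_pullback C P g) X \<in> Obj (pt C J')"
      using ob unfolding pt_def pt_pullback_def by simp
  next
    fix m assume m: "m \<in> Arr (pt C J)"
    show "AMap (pt_pullback C P g) m \<in> hom (pt C J') (OMap (pt_pullback C P g) (Dom (pt C J) m)) (OMap (pt_pullback C P g) (Cod (pt C J) m))"
      using AM[OF m] m unfolding hom_def pt_def pt_pullback_def by auto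
  next
    fix X assume X: "X \<in> Obj (pt C J)"
    obtain B p s where Xe: "X = (B,p,s)" by (cases X)
    have p: "p \<in> hom C B J" "B \<in> Obj C" using X Xe unfolding pt_def pt_obj_def by auto
    have pi: "p \<cdot>\<^bsub>C\<^esub> Id C B = p" using Comp_Id[OF p(1)] .
    note l = pullback_lift_props[OF pb[OF p(1)] L[OF Id_hom[OF p(2)] p(1) p(1) pi]]
    have "Id C (Dom C (snd (P p g))) = pullback_lift C (P p g) (Id C B \<cdot>\<^bsub>C\<^esub> fst (P p g)) (snd (P p g))"
    proof (rule l(4))
      show "Id C (Dom C (snd (P p g))) \<in> hom C (Dom C (snd (P p g))) (Dom C (snd (P p g)))"
        using Id_hom Dom_Obj a(2)[OF p(1)] unfolding hom_def by blast
    qed (simp_all add: Comp_Id[OF a(1)[OF p(1)]] Comp_Id[OF a(2)[OF p(1)]] Id_Comp[OF a(1)[OF p(1)]])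
    then show "AMap (pt_pullback C P g) (Id (pt C J) X) = Id (pt C J') (OMap (pt_pullback C P g) X)"
      unfolding Xe pt_def pt_pullback_def pt_pullback_obj_def by simp
  next
    fix m n assume m: "m \<in> Arr (pt C J)" and n: "n \<in> Arr (pt C J)" and mn: "Cod (pt C J) m = Dom (pt C J) n"
    from m obtain B' p' s' f B p s where me: "m = ((B',p',s'),f,(B,p,s))" and
      o: "(B', p', s') \<in> pt_obj C J" "(B, p, s) \<in> pt_obj C J" and f:
              "f \<in> hom C B' B" "p \<cdot>\<^bsub>C\<^esub> f = p'" "f \<cdot>\<^bsub>C\<^esub> s' = s" unfolding pt_def by auto
    from n mn me obtain h B2 p2 s2 where ne: "n = ((B,p,s),h,(B2,p2,s2))" and
      o2: "(B2, p2, s2) \<in> pt_obj C J" and h: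
              "h \<in> hom C B B2" "p2 \<cdot>\<^bsub>C\<^esub> h = p" "h \<cdot>\<^bsub>C\<^esub> s = s2" unfolding pt_def by auto
    have p: "p \<in> hom C B J" "p' \<in> hom C B' J" "p2 \<in> hom C B2 J" using o o2 unfolding pt_obj_def by auto
    have hf: "h \<cdot>\<^bsub>C\<^esub> f \<in> hom C B' B2" "p2 \<cdot>\<^bsub>C\<^esub> (h \<cdot>\<^bsub>C\<^esub> f) = p'" 
      using Comp_hom[OF f(1) h(1)] Comp_assoc[OF f(1) h(1) p(3)] h f by auto
    note l1 = pullback_lift_props[OF pb[OF p(1)] L[OF f(1) p(1,2) f(2)]]
    note l2 = pullback_lift_props[OF pb[OF p(3)] L[OF h(1) p(3,1) h(2)]]
    note l3 = pullback_lift_props[OF pb[OF p(3)] L[OF hf(1) p(3,2) hf(2)]]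
    have "pullback_lift C (P p2 g) (h \<cdot>\<^bsub>C\<^esub> fst (P p g)) (snd (P p g)) \<cdot>\<^bsub>C\<^esub> pullback_lift C (P p g) (f \<cdot>\<^bsub>C\<^esub> fst (P p' g)) (snd (P p' g))
      = pullback_lift C (P p2 g) ((h \<cdot>\<^bsub>C\<^esub> f) \<cdot>\<^bsub>C\<^esub> fst (P p' g)) (snd (P p' g))" (is "?a \<cdot>\<^bsub>C\<^esub> ?b = _")
    proof (rule l3(4))
      show "?a \<cdot>\<^bsub>C\<^esub> ?b \<in> hom C (Dom C (snd (P p' g))) (Dom C (snd (P p2 g)))" using Comp_hom[OF l1(1) l2(1)] .
      show "fst (P p2 g) \<cdot>\<^bsub>C\<^esub> ?a \<cdot>\<^bsub>C\<^esub> ?b = (h \<cdot>\<^bsub>C\<^esub> f) \<cdot>\<^bsub>C\<^esub> fst (P p' g)"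
        using Comp_assoc[OF l1(1) l2(1) a(1)[OF p(3)]] l2(2) Comp_assoc[OF l1(1) a(1)[OF p(1)] h(1)] l1(2)
          Comp_assoc[OF a(1)[OF p(2)] f(1) h(1)] by simp
      show "snd (P p2 g) \<cdot>\<^bsub>C\<^esub> ?a \<cdot>\<^bsub>C\<^esub> ?b = snd (P p' g)"
        using Comp_assoc[OF l1(1) l2(1) a(2)[OF p(3)]] l2(3) l1(3) by simp
    qed
    then show "AMap (pt_pullback C P g) (n \<cdot>\<^bsub>pt C J\<^esub> m) = AMap (pt_pullback C P g) n \<cdot>\<^bsub>pt C J'\<^esub> AMap (pt_pullback C P g) m"
      unfolding me ne pt_def pt_pullback_def by simp
  qed
qed

end

(*
  The functor G sending X to the augmentation p_X : F(X) \<rightarrow> I is left adjoint to K, and the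
  unit X \<rightarrow> K(G(X)) is invertible because \<eta>_X and the chosen kernel of U(p_X) are kernels of the
  same arrow. By a triangle identity K inverts the counit, so it suffices that K reflects
  isomorphisms. As I is initial, every f : B \<rightarrow> I is split by the unique arrow I \<rightarrow> B, and every
  arrow over I respects these splittings. So U turns arrows over I into morphisms of points over
  U(I), where protomodularity says that pulling back along 0 \<rightarrow> U(I), i.e. taking kernels,
  reflects isomorphisms; U reflects them by assumption.
*)
theory Submission
  imports Defs
begin

section \<open>Isomorphisms and functors\<close>

lemma homD: "f \<in> hom C x y \<Longrightarrow> f \<in> Arr C" "f \<in> hom C x y \<Longrightarrow> Dom C f = x" "f \<in> hom C x y \<Longrightarrow> Cod C f = y"
  unfolding hom_def by auto

lemma is_isoI:
  assumes "f \<in> hom C x y" "g \<in> hom C y x" "g \<cdot>\<^bsub>C\<^esub> f = Id C x" "f \<cdot>\<^bsub>C\<^esub> g = Id C y"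
  shows "is_iso C f"
  using assms unfolding is_iso_def hom_def by auto

lemma is_isoE:
  assumes "is_iso C f" "f \<in> hom C x y"
  obtains g where "g \<in> hom C y x" "g \<cdot>\<^bsub>C\<^esub> f = Id C x" "f \<cdot>\<^bsub>C\<^esub> g = Id C y"
  using assms unfolding is_iso_def by (auto simp: homD)

lemma (in category) hom_Obj:
  assumes "f \<in> hom C x y" shows "x \<in> Obj C" "y \<in> Obj C"
  using assms Dom_Obj Cod_Obj unfolding hom_def by auto

text \<open>The two-sided inverse \<open>h\<close> of \<open>f\<close> and the left inverse
  \<open>g\<close> coincide by associativity. This is how a triangle identity with an invertible
  unit makes the image of the counit invertible.\<close>

lemma (in category) is_iso_left_inverse:
  assumes "is_iso C f" and f: "f \<in> hom C x y" and g: "g \<in> hom C y x" and gf: "g \<cdot> f = Id C x"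
  shows "is_iso C g"
proof -
  obtain h where h: "h \<in> hom C y x" "f \<cdot> h = Id C y" using assms(1) f by (rule is_isoE)
  have "g = h"
    using Comp_assoc[OF h(1) f g] gf h Comp_Id[OF g] Id_Comp[OF h(1)] by simp
  then show ?thesis using is_isoI[OF g f] gf h(2) by simp
qed

lemma functor_Obj: "is_functor C D F \<Longrightarrow> x \<in> Obj C \<Longrightarrow> OMap F x \<in> Obj D"
  and functor_hom: "is_functor C D F \<Longrightarrow> f \<in> hom C x y \<Longrightarrow> AMap F f \<in> hom D (OMap F x) (OMap F y)"
  and functor_Id: "is_functor C D F \<Longrightarrow> x \<in> Obj C \<Longrightarrow> AMap F (Id C x) = Id D (OMap F x)"
  and functor_Comp: "is_functor C D F \<Longrightarrow> f \<in> hom C x y \<Longrightarrow> g \<in> hom C y w \<Longrightarrow>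
    AMap F (g \<cdot>\<^bsub>C\<^esub> f) = AMap F g \<cdot>\<^bsub>D\<^esub> AMap F f"
  unfolding is_functor_def hom_def by auto

lemma is_functorI:
  assumes "category C" "category D"
    and "\<And>x. x \<in> Obj C \<Longrightarrow> OMap F x \<in> Obj D"
    and "\<And>f x y. f \<in> hom C x y \<Longrightarrow> AMap F f \<in> hom D (OMap F x) (OMap F y)"
    and "\<And>x. x \<in> Obj C \<Longrightarrow> AMap F (Id C x) = Id D (OMap F x)"
    and "\<And>f g x y w. f \<in> hom C x y \<Longrightarrow> g \<in> hom C y w \<Longrightarrow>
      AMap F (g \<cdot>\<^bsub>C\<^esub> f) = AMap F g \<cdot>\<^bsub>D\<^esub> AMap F f"
  shows "is_functor C D F"
  using assms unfolding is_functor_def hom_def by auto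

lemma is_functor_id: "category C \<Longrightarrow> is_functor C C id_functor"
  by (rule is_functorI) (auto simp: id_functor_def)

lemma is_functor_comp:
  assumes F: "is_functor C D F" and G: "is_functor D E G"
  shows "is_functor C E (comp_functor G F)"
proof (rule is_functorI)
  show "category C" "category E" using F G unfolding is_functor_def by auto
qed (simp_all add: comp_functor_def functor_Obj[OF F] functor_Obj[OF G] functor_Id[OF F] functor_Id[OF G]
    functor_hom[OF F] functor_hom[OF G] functor_Comp[OF F]
    functor_Comp[OF G functor_hom[OF F] functor_hom[OF F]])

text \<open>The pointwise inverses are again natural. The equivalence needs this because
  \<open>equivalence_of_categories\<close> orients its two isomorphisms opposite to the unit and
  counit of an adjunction with right adjoint \<open>F\<close>.\<close>

lemma nat_iso_sym:
  assumes "nat_iso C D F G t"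
  shows "\<exists>t'. nat_iso C D G F t'"
proof -
  have F: "is_functor C D F" and G: "is_functor C D G"
    and th: "\<And>x. x \<in> Obj C \<Longrightarrow> t x \<in> hom D (OMap F x) (OMap G x)"
    and tn: "\<And>f. f \<in> Arr C \<Longrightarrow> t (Cod C f) \<cdot>\<^bsub>D\<^esub> AMap F f = AMap G f \<cdot>\<^bsub>D\<^esub> t (Dom C f)"
    and ti: "\<And>x. x \<in> Obj C \<Longrightarrow> is_iso D (t x)"
    using assms unfolding nat_iso_def nat_trans_def by auto
  interpret C: category C using F unfolding is_functor_def by blast
  interpret D: category D using F unfolding is_functor_def by blast
  have "\<forall>x. x \<in> Obj C \<longrightarrow> (\<exists>s. s \<in> hom D (OMap G x) (OMap F x) \<and>
      s \<cdot>\<^bsub>D\<^esub> t x = Id D (OMap F x) \<and> t x \<cdot>\<^bsub>D\<^esub> s = Id D (OMap G x))"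
    using th ti is_isoE by metis
  then obtain s where s: "\<And>x. x \<in> Obj C \<Longrightarrow> s x \<in> hom D (OMap G x) (OMap F x)"
      "\<And>x. x \<in> Obj C \<Longrightarrow> s x \<cdot>\<^bsub>D\<^esub> t x = Id D (OMap F x)"
      "\<And>x. x \<in> Obj C \<Longrightarrow> t x \<cdot>\<^bsub>D\<^esub> s x = Id D (OMap G x)"
    by metis
  have "s y \<cdot>\<^bsub>D\<^esub> AMap G f = AMap F f \<cdot>\<^bsub>D\<^esub> s x" if f: "f \<in> hom C x y" for f x y
  proof -
    note x = C.hom_Obj(1)[OF f] and y = C.hom_Obj(2)[OF f]
    note Ff = functor_hom[OF F f] and Gf = functor_hom[OF G f]
    \<comment> \<open>The identity \<open>s y \<cdot> t y\<close> is inserted in front, so that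
      naturality of \<open>t\<close> applies in the middle and \<open>t x \<cdot> s x\<close>
      cancels afterwards.\<close>
    have "AMap F f \<cdot>\<^bsub>D\<^esub> s x = s y \<cdot>\<^bsub>D\<^esub> ((t y \<cdot>\<^bsub>D\<^esub> AMap F f) \<cdot>\<^bsub>D\<^esub> s x)"
      using D.Comp_assoc[OF s(1)[OF x] Ff th[OF y]] D.Id_Comp[OF D.Comp_hom[OF s(1)[OF x] Ff]]
        D.Comp_assoc[OF D.Comp_hom[OF s(1)[OF x] Ff] th[OF y] s(1)[OF y]] s(2)[OF y] by simp
    also have "\<dots> = s y \<cdot>\<^bsub>D\<^esub> AMap G f"
      using tn[of f] f D.Comp_assoc[OF s(1)[OF x] th[OF x] Gf] s(3)[OF x] D.Comp_Id[OF Gf]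
      by (simp add: homD)
    finally show ?thesis ..
  qed
  then have "nat_trans C D G F s"
    using F G s(1) unfolding nat_trans_def hom_def by auto
  moreover have "is_iso D (s x)" if "x \<in> Obj C" for x
    using is_isoI[OF s(1) th s(3) s(2)] that by blast
  ultimately show ?thesis unfolding nat_iso_def by blast
qed

section \<open>Slice categories\<close>

lemma slice_Obj: "f \<in> Obj (slice C I) \<longleftrightarrow> f \<in> hom C (Dom C f) I"
  unfolding slice_def hom_def by auto

lemma slice_hom:
  "(f, h, g) \<in> hom (slice C I) f' g' \<longleftrightarrow> f = f' \<and> g = g' \<and>
    f \<in> hom C (Dom C f) I \<and> g \<in> hom C (Dom C g) I \<and> h \<in> hom C (Dom C f) (Dom C g) \<and> g \<cdot>\<^bsub>C\<^esub> h = f"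
  unfolding slice_def hom_def by auto

lemma slice_homE:
  assumes "m \<in> hom (slice C I) f g"
  obtains h where "m = (f, h, g)" "f \<in> hom C (Dom C f) I" "g \<in> hom C (Dom C g) I"
    "h \<in> hom C (Dom C f) (Dom C g)" "g \<cdot>\<^bsub>C\<^esub> h = f"
proof -
  obtain f' h g' where "m = (f', h, g')" by (cases m)
  then show thesis using assms that slice_hom by metis
qed

lemma slice_simps:
  "Id (slice C I) f = (f, Id C (Dom C f), f)"
  "(g', k, l) \<cdot>\<^bsub>slice C I\<^esub> (f, h, g) = (f, k \<cdot>\<^bsub>C\<^esub> h, l)"
  unfolding slice_def by auto

text \<open>The inverse \<open>k\<close> of \<open>h\<close> is automatically an arrow over
  \<open>I\<close>: composing \<open>g \<cdot> h = f\<close> with \<open>k\<close> gives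
  \<open>f \<cdot> k = g\<close>.\<close>

lemma (in category) is_iso_slice:
  assumes m: "(f, h, g) \<in> hom (slice C I) f g" and iso: "is_iso C h"
  shows "is_iso (slice C I) (f, h, g)"
proof -
  have f: "f \<in> hom C (Dom C f) I" and g: "g \<in> hom C (Dom C g) I"
    and h: "h \<in> hom C (Dom C f) (Dom C g)" and gh: "g \<cdot> h = f"
    using m unfolding slice_hom by auto
  obtain k where k: "k \<in> hom C (Dom C g) (Dom C f)" "k \<cdot> h = Id C (Dom C f)" "h \<cdot> k = Id C (Dom C g)"
    using iso h by (rule is_isoE)
  have "f \<cdot> k = g" using Comp_assoc[OF k(1) h g] gh k(3) Comp_Id[OF g] by simp
  then have "(g, k, f) \<in> hom (slice C I) g f" using f g k(1) unfolding slice_hom by simp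
  then show ?thesis using is_isoI[OF m] k by (simp add: slice_simps)
qed


section \<open>Kernels and protomodularity\<close>

locale category_with_zero = category +
  fixes z
  assumes zero: "is_zero_object C z"
begin

lemma from_zero: "x \<in> Obj C \<Longrightarrow> from_zero C z x \<in> hom C z x"
  and from_zero_unique: "f \<in> hom C z x \<Longrightarrow> f = from_zero C z x"
  and to_zero: "x \<in> Obj C \<Longrightarrow> to_zero C z x \<in> hom C x z"
  and to_zero_unique: "g \<in> hom C x z \<Longrightarrow> g = to_zero C z x"
proof -
  have i: "\<exists>!f. f \<in> hom C z x" and t: "\<exists>!f. f \<in> hom C x z" if "x \<in> Obj C" for x
    using zero that unfolding is_zero_object_def is_initial_def is_terminal_def by auto
  show F: "from_zero C z x \<in> hom C z x" and T: "to_zero C z x \<in> hom C x z" if "x \<in> Obj C"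
    using theI'[OF i[OF that]] theI'[OF t[OF that]] unfolding from_zero_def to_zero_def .
  show "f = from_zero C z x" if "f \<in> hom C z x"
    using the1_equality[OF i that] hom_Obj[OF that] unfolding from_zero_def by simp
  show "g = to_zero C z x" if "g \<in> hom C x z"
    using the1_equality[OF t that] hom_Obj[OF that] unfolding to_zero_def by simp
qed

section \<open>Zero arrows and the universal property of kernels\<close>

lemma zero_arrow_Comp:
  assumes f: "f \<in> hom C w x" and y: "y \<in> Obj C"
  shows "zero_arrow C z x y \<cdot> f = zero_arrow C z w y"
  using Comp_assoc[OF f to_zero from_zero[OF y]] hom_Obj[OF f]
    to_zero_unique[OF Comp_hom[OF f to_zero]] unfolding zero_arrow_def by simp

lemma kernel_hom: "is_kernel C z p k \<Longrightarrow> p \<in> hom C x y \<Longrightarrow> k \<in> hom C (Dom C k) x"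
  unfolding is_kernel_def is_pullback_def hom_def by auto

lemma kernel_Comp: "is_kernel C z p k \<Longrightarrow> p \<in> hom C x y \<Longrightarrow> p \<cdot> k = zero_arrow C z (Dom C k) y"
  unfolding is_kernel_def is_pullback_def zero_arrow_def hom_def by auto

text \<open>In the pullback defining a kernel, the condition on the projection to \<open>z\<close>
  is void because arrows into \<open>z\<close> are unique. What remains is the usual description by
  zero arrows.\<close>

lemma kernel_universal:
  assumes k: "is_kernel C z p k" and p: "p \<in> hom C x y" and h: "h \<in> hom C w x"
    and ph: "p \<cdot> h = zero_arrow C z w y"
  shows "\<exists>!u. u \<in> hom C w (Dom C k) \<and> k \<cdot> u = h"
proof -
  have y: "y \<in> Obj C" and w: "w \<in> Obj C" using hom_Obj p h by auto
  have k0: "k \<in> hom C (Dom C k) x" using k p by (rule kernel_hom)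
  have "\<exists>!u. u \<in> hom C w (Dom C k) \<and> k \<cdot> u = h \<and> to_zero C z (Dom C k) \<cdot> u = to_zero C z w"
    using k h ph to_zero[OF w] from_zero[OF y] p
    unfolding is_kernel_def is_pullback_def zero_arrow_def by (auto simp: homD)
  moreover have "to_zero C z (Dom C k) \<cdot> u = to_zero C z w" if "u \<in> hom C w (Dom C k)" for u
    using to_zero_unique[OF Comp_hom[OF that to_zero]] hom_Obj[OF k0] by simp
  ultimately show ?thesis by metis
qed

text \<open>Kernels are monic: \<open>u\<close> and \<open>v\<close> both factor the arrow
  \<open>k \<cdot> v\<close>, which \<open>p\<close> sends to zero, and such factorizations are
  unique.\<close>

lemma kernel_cancel:
  assumes k: "is_kernel C z p k" and p: "p \<in> hom C x y"
    and u: "u \<in> hom C w (Dom C k)" and v: "v \<in> hom C w (Dom C k)" and uv: "k \<cdot> u = k \<cdot> v"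
  shows "u = v"
proof -
  have k0: "k \<in> hom C (Dom C k) x" using k p by (rule kernel_hom)
  have "p \<cdot> (k \<cdot> v) = zero_arrow C z w y"
    using Comp_assoc[OF v k0 p] kernel_Comp[OF k p] zero_arrow_Comp[OF v] hom_Obj[OF p] by simp
  from kernel_universal[OF k p Comp_hom[OF v k0] this] show ?thesis using u v uv by auto
qed

text \<open>Each of the two kernels factors through the other, and the composites are identities
  because kernels are monic.\<close>

lemma kernel_comparison_iso:
  assumes k: "is_kernel C z p k" and l: "is_kernel C z p l" and p: "p \<in> hom C x y"
    and u: "u \<in> hom C (Dom C k) (Dom C l)" and lu: "l \<cdot> u = k"
  shows "is_iso C u"
proof -
  have k0: "k \<in> hom C (Dom C k) x" and l0: "l \<in> hom C (Dom C l) x"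
    using k l p kernel_hom by blast+
  obtain v where v: "v \<in> hom C (Dom C l) (Dom C k)" "k \<cdot> v = l"
    using kernel_universal[OF k p l0 kernel_Comp[OF l p]] by blast
  show ?thesis
  proof (rule is_isoI[OF u v(1)])
    show "v \<cdot> u = Id C (Dom C k)"
      using kernel_cancel[OF k p Comp_hom[OF u v(1)] Id_hom] Comp_assoc[OF u v(1) k0] v(2) lu
        hom_Obj[OF k0] Comp_Id[OF k0] by simp
    show "u \<cdot> v = Id C (Dom C l)"
      using kernel_cancel[OF l p Comp_hom[OF v(1) u] Id_hom] Comp_assoc[OF v(1) u l0] v(2) lu
        hom_Obj[OF l0] Comp_Id[OF l0] by simp
  qed
qed

text \<open>Since \<open>protomodular\<close> speaks of every choice of pullbacks, it may be applied
  to one that agrees with the given kernels along arrows out of \<open>z\<close>. Change of base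
  along \<open>0 \<rightarrow> J\<close> then literally takes the chosen kernels.\<close>

lemma kernel_extending_pullback_choice:
  assumes pb: "has_pullbacks C" and ker: "kernel_choice C z ker"
  obtains P where "pullback_choice C P"
    "\<And>p g. Dom C g = z \<Longrightarrow> P p g = (ker p, to_zero C z (Dom C (ker p)))"
proof -
  \<comment> \<open>The first case does not ask that \<open>p\<close> and \<open>g\<close> share a
    codomain; \<open>pullback_choice\<close> constrains only matching pairs, and the equation for
    \<open>P\<close> stays free of side conditions on \<open>p\<close>.\<close>
  define P where "P p g = (if Dom C g = z then (ker p, to_zero C z (Dom C (ker p)))
    else SOME ab. is_pullback C p g (fst ab) (snd ab))" for p g
  have "is_pullback C p g (fst (P p g)) (snd (P p g))"
    if p: "p \<in> Arr C" and g: "g \<in> Arr C" and pg: "Cod C p = Cod C g" for p g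
  proof (cases "Dom C g = z")
    case True
    \<comment> \<open>As \<open>z\<close> is initial, the test \<open>Dom C g = z\<close> already
      determines \<open>g\<close> from its codomain.\<close>
    have "g = from_zero C z (Cod C p)"
      by (rule from_zero_unique) (use g pg True in \<open>auto simp: hom_def\<close>)
    then show ?thesis using True ker p unfolding P_def kernel_choice_def is_kernel_def by auto
  next
    case False
    have "\<exists>ab. is_pullback C p g (fst ab) (snd ab)"
      using pb p g pg unfolding has_pullbacks_def by fastforce
    from someI_ex[OF this] show ?thesis unfolding P_def using False by simp
  qed
  then have "pullback_choice C P" unfolding pullback_choice_def by blast
  then show thesis by (rule that) (simp add: P_def)
qed

section \<open>Isomorphisms of points and change of base to the zero object\<close>

lemma pt_Arr:
  "((B', p', s'), f, (B, p, s)) \<in> Arr (pt C J) \<longleftrightarrow>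
    (B', p', s') \<in> pt_obj C J \<and> (B, p, s) \<in> pt_obj C J \<and>
    f \<in> hom C B' B \<and> p \<cdot> f = p' \<and> f \<cdot> s' = s"
  unfolding pt_def by auto

text \<open>Over the zero object the conditions on projection and section are void.\<close>

lemma is_iso_pt_zero:
  assumes m: "((B', p', s'), f, (B, p, s)) \<in> Arr (pt C z)" and iso: "is_iso C f"
  shows "is_iso (pt C z) ((B', p', s'), f, (B, p, s))"
proof -
  have X: "(B', p', s') \<in> pt_obj C z" and Y: "(B, p, s) \<in> pt_obj C z" and f: "f \<in> hom C B' B"
    using m unfolding pt_Arr by auto
  have p: "p \<in> hom C B z" "p' \<in> hom C B' z" "s \<in> hom C z B" "s' \<in> hom C z B'"
    using X Y unfolding pt_obj_def by auto
  obtain g where g: "g \<in> hom C B B'" "g \<cdot> f = Id C B'" "f \<cdot> g = Id C B" using iso f by (rule is_isoE)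
  have "p' \<cdot> g = p" "g \<cdot> s = s'"
    using to_zero_unique[OF Comp_hom[OF g(1) p(2)]] to_zero_unique[OF p(1)]
      from_zero_unique[OF Comp_hom[OF p(3) g(1)]] from_zero_unique[OF p(4)] by simp_all
  then have "((B, p, s), g, (B', p', s')) \<in> Arr (pt C z)" unfolding pt_Arr using X Y g(1) by simp
  then have "((B, p, s), g, (B', p', s')) \<in> hom (pt C z) (B, p, s) (B', p', s')"
    "((B', p', s'), f, (B, p, s)) \<in> hom (pt C z) (B', p', s') (B, p, s)"
    using m unfolding hom_def[of "pt C z"] by (simp_all add: pt_def)
  from is_isoI[OF this(2,1)] show ?thesis by (simp add: pt_def g(2,3))
qed

lemma is_iso_underlying_pt:
  assumes m: "((B', p', s'), f, (B, p, s)) \<in> Arr (pt C J)"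
    and iso: "is_iso (pt C J) ((B', p', s'), f, (B, p, s))"
  shows "is_iso C f"
proof -
  obtain n where n: "n \<in> hom (pt C J) (B, p, s) (B', p', s')"
      "n \<cdot>\<^bsub>pt C J\<^esub> ((B', p', s'), f, (B, p, s)) = Id (pt C J) (B', p', s')"
      "((B', p', s'), f, (B, p, s)) \<cdot>\<^bsub>pt C J\<^esub> n = Id (pt C J) (B, p, s)"
    by (rule is_isoE[OF iso, of "(B', p', s')" "(B, p, s)"]) (use m in \<open>auto simp: hom_def pt_def\<close>)
  obtain g where "n = ((B, p, s), g, (B', p', s'))" "g \<in> hom C B B'"
    using n(1) unfolding hom_def[of "pt C J"] unfolding pt_def by auto
  then show ?thesis using n(2,3) m unfolding pt_Arr by (intro is_isoI) (auto simp: pt_def)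
qed

text \<open>This is the split short five lemma over a fixed base \<open>J\<close>. Change of base
  along \<open>0 \<rightarrow> J\<close> turns the morphism of points \<open>f\<close> into one over
  \<open>z\<close> with underlying arrow \<open>u\<close>; there invertibility of \<open>u\<close>
  suffices, and protomodularity carries it back to \<open>f\<close>.\<close>

lemma protomodular_kernel_conservative:
  assumes proto: "protomodular C" and ker: "kernel_choice C z ker"
    and X: "(B', p', s') \<in> pt_obj C J" and Y: "(B, p, s) \<in> pt_obj C J"
    and f: "f \<in> hom C B' B" "p \<cdot> f = p'" "f \<cdot> s' = s"
    and u: "u \<in> hom C (Dom C (ker p')) (Dom C (ker p))" "ker p \<cdot> u = f \<cdot> ker p'" "is_iso C u"
  shows "is_iso C f"
proof -
  have p: "p \<in> hom C B J" "p' \<in> hom C B' J" using X Y unfolding pt_obj_def by auto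
  then have J: "J \<in> Obj C" using hom_Obj by blast
  have kp: "is_kernel C z p (ker p)" and kp': "is_kernel C z p' (ker p')"
    using ker p unfolding kernel_choice_def by (auto simp: homD)
  obtain P where P: "pullback_choice C P"
    "\<And>p g. Dom C g = z \<Longrightarrow> P p g = (ker p, to_zero C z (Dom C (ker p)))"
    using kernel_extending_pullback_choice[OF _ ker] proto unfolding protomodular_def by blast
  let ?g = "from_zero C z J"
  have g: "?g \<in> hom C z J" using from_zero[OF J] .
  note Pg = P(2)[OF homD(2)[OF g]]
  let ?m = "((B', p', s'), f, (B, p, s))"
  have m: "?m \<in> Arr (pt C J)" using X Y f unfolding pt_Arr by simp
  \<comment> \<open>\<open>?l\<close> is the underlying arrow of the image of \<open>?m\<close>
    under change of base along \<open>?g\<close>. As \<open>u\<close> satisfies the equations that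
    define this lift, uniqueness will give \<open>u = ?l\<close>.\<close>
  let ?l = "pullback_lift C (P p ?g) (f \<cdot> fst (P p' ?g)) (snd (P p' ?g))"
  have "is_pullback C p ?g (fst (P p ?g)) (snd (P p ?g))"
    using P(1) p(1) g unfolding pullback_choice_def by (auto simp: homD)
  note pb = pullback_lift_props(4)[OF this]
  have k0: "ker p' \<in> hom C (Dom C (ker p')) B'" using kernel_hom[OF kp' p(2)] .
  note K = hom_Obj(1)[OF k0]
  have kl: "Dom C (to_zero C z (Dom C (ker p))) = Dom C (ker p)"
    using homD(2)[OF to_zero[OF hom_Obj(1)[OF kernel_hom[OF kp p(1)]]]] .
  have "u = ?l"
  proof (rule pb[where w = "Dom C (ker p')"])
    show "f \<cdot> fst (P p' ?g) \<in> hom C (Dom C (ker p')) (Dom C p)"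
      using Comp_hom[OF k0 f(1)] p by (simp add: Pg homD)
    show "snd (P p' ?g) \<in> hom C (Dom C (ker p')) (Dom C ?g)"
      using to_zero[OF K] g by (simp add: Pg homD)
    show "p \<cdot> (f \<cdot> fst (P p' ?g)) = ?g \<cdot> snd (P p' ?g)"
      using Comp_assoc[OF k0 f(1) p(1)] f(2) kernel_Comp[OF kp' p(2)]
      by (simp add: Pg zero_arrow_def)
    show "u \<in> hom C (Dom C (ker p')) (Dom C (snd (P p ?g)))"
      using u(1) kl by (simp add: Pg)
    show "fst (P p ?g) \<cdot> u = f \<cdot> fst (P p' ?g)" using u(2) by (simp add: Pg)
    show "snd (P p ?g) \<cdot> u = snd (P p' ?g)"
      using to_zero_unique[OF Comp_hom[OF u(1) to_zero]] hom_Obj(2)[OF u(1)] by (simp add: Pg)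
  qed
  then have l: "is_iso C ?l" using u(3) by simp
  have fu: "is_functor (pt C J) (pt C z) (pt_pullback C P ?g)"
    by (rule functor_pt_pullback[OF category_axioms P(1) g])
  have "AMap (pt_pullback C P ?g) ?m =
      (pt_pullback_obj C P ?g (B', p', s'), ?l, pt_pullback_obj C P ?g (B, p, s))"
    unfolding pt_pullback_def by simp
  moreover have "AMap (pt_pullback C P ?g) ?m \<in> Arr (pt C z)"
    using fu m unfolding is_functor_def hom_def by blast
  ultimately have "is_iso (pt C z) (AMap (pt_pullback C P ?g) ?m)"
    using is_iso_pt_zero l by (cases "pt_pullback_obj C P ?g (B', p', s')";
      cases "pt_pullback_obj C P ?g (B, p, s)") auto
  moreover have "conservative (pt C J) (pt C z) (pt_pullback C P ?g)"
    using proto P(1) g unfolding protomodular_def by (metis homD)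
  ultimately have "is_iso (pt C J) ?m" using m unfolding conservative_def by blast
  then show ?thesis by (rule is_iso_underlying_pt[OF m])
qed

end


section \<open>The kernel functor and its left adjoint\<close>

locale kernel_adjunction =
  A: category_with_zero A z + B: category B
  for A :: "('oa, 'ma) category" and B :: "('ob, 'mb) category" and z :: 'oa +
  fixes U :: "('ob, 'mb, 'oa, 'ma) functor_maps" and F :: "('oa, 'ma, 'ob, 'mb) functor_maps"
    and \<eta> :: "'oa \<Rightarrow> 'ma" and ker :: "'ma \<Rightarrow> 'ma"
  assumes adj: "left_adjoint_with_unit A B F U \<eta>"
    and ker: "kernel_choice A z ker"
begin

abbreviation I where "I \<equiv> OMap F z"
abbreviation S where "S \<equiv> slice B I"
abbreviation K where "K \<equiv> kernel_functor B A U ker"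
abbreviation aug where "aug \<equiv> augmentation A B F U \<eta> z"

section \<open>Transposes and augmentations\<close>

lemma F: "is_functor A B F" and U: "is_functor B A U"
  using adj unfolding left_adjoint_with_unit_def by auto

lemma unit_hom: "X \<in> Obj A \<Longrightarrow> \<eta> X \<in> hom A X (OMap U (OMap F X))"
  and unit_natural: "f \<in> hom A X Y \<Longrightarrow> \<eta> Y \<cdot>\<^bsub>A\<^esub> f = AMap U (AMap F f) \<cdot>\<^bsub>A\<^esub> \<eta> X"
  using adj unfolding left_adjoint_with_unit_def nat_trans_def
  by (auto simp: id_functor_def comp_functor_def hom_def)

text \<open>The uniqueness half of the universal property of \<open>\<eta> X\<close>. It lets
  equations between arrows out of \<open>OMap F X\<close> be checked in \<open>A\<close>.\<close>

lemma transpose_cancel: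
  assumes X: "X \<in> Obj A" and g: "g \<in> hom B (OMap F X) Y" and g': "g' \<in> hom B (OMap F X) Y"
    and e: "AMap U g \<cdot>\<^bsub>A\<^esub> \<eta> X = AMap U g' \<cdot>\<^bsub>A\<^esub> \<eta> X"
  shows "g = g'"
  using left_adjoint_universal[OF adj X B.hom_Obj(2)[OF g]
      A.Comp_hom[OF unit_hom[OF X] functor_hom[OF U g]]] g g' e by metis

lemma initial: "is_initial B I"
  using is_initial_left_adjoint_zero[OF adj A.zero] .

lemma UI: "OMap U I \<in> Obj A"
  using functor_Obj[OF U] initial unfolding is_initial_def by blast

lemma aug:
  assumes "X \<in> Obj A"
  shows aug_hom: "aug X \<in> hom B (OMap F X) I"
    and aug_unit: "AMap U (aug X) \<cdot>\<^bsub>A\<^esub> \<eta> X = zero_arrow A z X (OMap U I)"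
  using theI'[OF augmentation_unique[OF adj A.zero assms]] unfolding augmentation_def by auto

lemma aug_unique:
  assumes X: "X \<in> Obj A" and g: "g \<in> hom B (OMap F X) I"
    and "AMap U g \<cdot>\<^bsub>A\<^esub> \<eta> X = zero_arrow A z X (OMap U I)"
  shows "g = aug X"
  using transpose_cancel[OF X g aug_hom[OF X]] aug_unit[OF X] assms(3) by simp

text \<open>By naturality of \<open>\<eta>\<close> the left side has transpose a zero arrow composed
  with \<open>f\<close>, which is zero again, so \<open>aug_unique\<close> applies. This makes
  \<open>AMap F f\<close> an arrow of the slice.\<close>

lemma aug_natural:
  assumes f: "f \<in> hom A X Y"
  shows "aug Y \<cdot>\<^bsub>B\<^esub> AMap F f = aug X"
proof -
  note X = A.hom_Obj(1)[OF f] and Y = A.hom_Obj(2)[OF f]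
  note Ff = functor_hom[OF F f]
  show ?thesis
  proof (rule aug_unique[OF X B.Comp_hom[OF Ff aug_hom[OF Y]]])
    have "AMap U (aug Y \<cdot>\<^bsub>B\<^esub> AMap F f) \<cdot>\<^bsub>A\<^esub> \<eta> X = AMap U (aug Y) \<cdot>\<^bsub>A\<^esub> (\<eta> Y \<cdot>\<^bsub>A\<^esub> f)"
      using functor_Comp[OF U Ff aug_hom[OF Y]] unit_natural[OF f]
        A.Comp_assoc[OF unit_hom[OF X] functor_hom[OF U Ff] functor_hom[OF U aug_hom[OF Y]]] by simp
    also have "\<dots> = zero_arrow A z X (OMap U I)"
      using A.Comp_assoc[OF f unit_hom[OF Y] functor_hom[OF U aug_hom[OF Y]]] aug_unit[OF Y]
        A.zero_arrow_Comp[OF f UI] by simp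
    finally show "AMap U (aug Y \<cdot>\<^bsub>B\<^esub> AMap F f) \<cdot>\<^bsub>A\<^esub> \<eta> X = zero_arrow A z X (OMap U I)" .
  qed
qed

section \<open>The kernel functor on the slice\<close>

lemma ker_kernel: "f \<in> hom B x I \<Longrightarrow> is_kernel A z (AMap U f) (ker (AMap U f))"
  using ker functor_hom[OF U] unfolding kernel_choice_def by (metis homD(1))

lemma ker_hom: "f \<in> hom B x I \<Longrightarrow> ker (AMap U f) \<in> hom A (OMap K f) (OMap U x)"
  using A.kernel_hom[OF ker_kernel functor_hom[OF U]] unfolding kernel_functor_def by simp

lemma ker_cancel:
  assumes "f \<in> hom B x I" "u \<in> hom A w (OMap K f)" "v \<in> hom A w (OMap K f)"
    "ker (AMap U f) \<cdot>\<^bsub>A\<^esub> u = ker (AMap U f) \<cdot>\<^bsub>A\<^esub> v"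
  shows "u = v"
  using A.kernel_cancel[OF ker_kernel[OF assms(1)] functor_hom[OF U assms(1)], of u w v] assms(2-4)
  unfolding kernel_functor_def by simp

lemma ker_universal:
  assumes f: "f \<in> hom B x I" and "h \<in> hom A w (OMap U x)"
    and "AMap U f \<cdot>\<^bsub>A\<^esub> h = zero_arrow A z w (OMap U I)"
  shows "\<exists>!u. u \<in> hom A w (OMap K f) \<and> ker (AMap U f) \<cdot>\<^bsub>A\<^esub> u = h"
  using A.kernel_universal[OF ker_kernel[OF f] functor_hom[OF U f] assms(2,3)]
  unfolding kernel_functor_def by simp

lemma ker_zero:
  "f \<in> hom B x I \<Longrightarrow> AMap U f \<cdot>\<^bsub>A\<^esub> ker (AMap U f) = zero_arrow A z (OMap K f) (OMap U I)"
  using A.kernel_Comp[OF ker_kernel functor_hom[OF U]] unfolding kernel_functor_def by simp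

text \<open>The description by \<open>THE\<close> is legitimate: since
  \<open>g \<cdot> h = f\<close>, the arrow \<open>AMap U g\<close> kills
  \<open>AMap U h \<cdot> ker (AMap U f)\<close>, which therefore factors uniquely through the
  kernel of \<open>AMap U g\<close>.\<close>

lemma K_Arr:
  assumes m: "(f, h, g) \<in> hom S f g"
  shows "AMap K (f, h, g) \<in> hom A (OMap K f) (OMap K g)"
    and "ker (AMap U g) \<cdot>\<^bsub>A\<^esub> AMap K (f, h, g) = AMap U h \<cdot>\<^bsub>A\<^esub> ker (AMap U f)"
proof -
  have f: "f \<in> hom B (Dom B f) I" and g: "g \<in> hom B (Dom B g) I"
    and h: "h \<in> hom B (Dom B f) (Dom B g)" and gh: "g \<cdot>\<^bsub>B\<^esub> h = f"
    using m unfolding slice_hom by auto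
  have "AMap U g \<cdot>\<^bsub>A\<^esub> (AMap U h \<cdot>\<^bsub>A\<^esub> ker (AMap U f)) = zero_arrow A z (OMap K f) (OMap U I)"
    using A.Comp_assoc[OF ker_hom[OF f] functor_hom[OF U h] functor_hom[OF U g]]
      functor_Comp[OF U h g] gh ker_zero[OF f] by simp
  from theI'[OF ker_universal[OF g A.Comp_hom[OF ker_hom[OF f] functor_hom[OF U h]] this]]
  show "AMap K (f, h, g) \<in> hom A (OMap K f) (OMap K g)"
    "ker (AMap U g) \<cdot>\<^bsub>A\<^esub> AMap K (f, h, g) = AMap U h \<cdot>\<^bsub>A\<^esub> ker (AMap U f)"
    unfolding kernel_functor_def by auto
qed

text \<open>Kernels being monic, both functor laws are checked after composing with the kernel at
  the target, where \<open>K_Arr\<close> reduces them to the functor laws of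
  \<open>U\<close>.\<close>

lemma K: "is_functor S A K"
proof (rule is_functorI[OF category_slice[OF B.category_axioms] A.category_axioms])
  fix f assume f: "f \<in> Obj S"
  then have f0: "f \<in> hom B (Dom B f) I" unfolding slice_Obj .
  show o: "OMap K f \<in> Obj A" using A.hom_Obj[OF ker_hom[OF f0]] by simp
  interpret S: category S using category_slice[OF B.category_axioms] .
  have m: "(f, Id B (Dom B f), f) \<in> hom S f f" using S.Id_hom[OF f] by (simp add: slice_simps)
  show "AMap K (Id S f) = Id A (OMap K f)" unfolding slice_simps
    by (rule ker_cancel[OF f0 K_Arr(1)[OF m] A.Id_hom[OF o]])
      (simp add: K_Arr(2)[OF m] functor_Id[OF U B.hom_Obj(1)[OF f0]]
        A.Id_Comp[OF ker_hom[OF f0]] A.Comp_Id[OF ker_hom[OF f0]])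
next
  fix m f g assume "m \<in> hom S f g"
  then show "AMap K m \<in> hom A (OMap K f) (OMap K g)" using K_Arr(1) slice_homE by metis
next
  fix m n f g l assume m: "m \<in> hom S f g" and n: "n \<in> hom S g l"
  interpret S: category S using category_slice[OF B.category_axioms] .
  obtain h where h: "m = (f, h, g)" "f \<in> hom B (Dom B f) I" "h \<in> hom B (Dom B f) (Dom B g)"
    using m by (rule slice_homE)
  obtain k where k: "n = (g, k, l)" "l \<in> hom B (Dom B l) I" "k \<in> hom B (Dom B g) (Dom B l)"
    "g \<in> hom B (Dom B g) I"
    using n by (rule slice_homE)
  have nm: "(f, k \<cdot>\<^bsub>B\<^esub> h, l) \<in> hom S f l" using S.Comp_hom[OF m n] h k by (simp add: slice_simps)
  note m' = m[unfolded h(1)] and n' = n[unfolded k(1)]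
  note Uh = functor_hom[OF U h(3)] and Uk = functor_hom[OF U k(3)]
  show "AMap K (n \<cdot>\<^bsub>S\<^esub> m) = AMap K n \<cdot>\<^bsub>A\<^esub> AMap K m" unfolding h(1) k(1) slice_simps
  proof (rule ker_cancel[OF k(2) K_Arr(1)[OF nm] A.Comp_hom[OF K_Arr(1)[OF m'] K_Arr(1)[OF n']]])
    have "ker (AMap U l) \<cdot>\<^bsub>A\<^esub> (AMap K (g, k, l) \<cdot>\<^bsub>A\<^esub> AMap K (f, h, g))
        = (AMap U k \<cdot>\<^bsub>A\<^esub> ker (AMap U g)) \<cdot>\<^bsub>A\<^esub> AMap K (f, h, g)"
      using A.Comp_assoc[OF K_Arr(1)[OF m'] K_Arr(1)[OF n'] ker_hom[OF k(2)]] K_Arr(2)[OF n'] by simp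
    also have "\<dots> = AMap U k \<cdot>\<^bsub>A\<^esub> (AMap U h \<cdot>\<^bsub>A\<^esub> ker (AMap U f))"
      using A.Comp_assoc[OF K_Arr(1)[OF m'] ker_hom[OF k(4)] Uk] K_Arr(2)[OF m'] by simp
    also have "\<dots> = AMap U (k \<cdot>\<^bsub>B\<^esub> h) \<cdot>\<^bsub>A\<^esub> ker (AMap U f)"
      using A.Comp_assoc[OF ker_hom[OF h(2)] Uh Uk] functor_Comp[OF U h(3) k(3)] by simp
    finally show "ker (AMap U l) \<cdot>\<^bsub>A\<^esub> AMap K (f, k \<cdot>\<^bsub>B\<^esub> h, l)
        = ker (AMap U l) \<cdot>\<^bsub>A\<^esub> (AMap K (g, k, l) \<cdot>\<^bsub>A\<^esub> AMap K (f, h, g))"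
      using K_Arr(2)[OF nm] by simp
  qed
qed

text \<open>The lemma on morphisms of points applies to \<open>AMap U h\<close>, with
  \<open>AMap K m\<close> as the induced arrow between kernels. Conservativity of \<open>U\<close>
  then inverts \<open>h\<close>, and the inverse lies over \<open>I\<close>.\<close>

lemma K_conservative:
  assumes proto: "protomodular A" and cons: "conservative B A U"
  shows "conservative S A K"
  unfolding conservative_def
proof (intro ballI impI)
  interpret S: category S using category_slice[OF B.category_axioms] .
  fix m assume mA: "m \<in> Arr S" and iso: "is_iso A (AMap K m)"
  then have m0: "m \<in> hom S (Dom S m) (Cod S m)" by (simp add: hom_def)
  obtain f h g where fhg: "m = (f, h, g)" "f \<in> hom B (Dom B f) I" "g \<in> hom B (Dom B g) I"
    "h \<in> hom B (Dom B f) (Dom B g)" "g \<cdot>\<^bsub>B\<^esub> h = f" "(f, h, g) \<in> hom S f g"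
    using m0 slice_homE[OF m0] by metis
  have init: "\<exists>!i. i \<in> hom B I Y" if "Y \<in> Obj B" for Y
    using initial that unfolding is_initial_def by blast
  have iI: "I \<in> Obj B" using initial unfolding is_initial_def by blast
  \<comment> \<open>The composite \<open>f \<cdot> i\<close> is an endomorphism of the initial
    object \<open>I\<close>, hence the identity.\<close>
  have point: "\<exists>i \<in> hom B I (Dom B f). f \<cdot>\<^bsub>B\<^esub> i = Id B I" if f: "f \<in> hom B (Dom B f) I" for f
    using init[OF B.hom_Obj(1)[OF f]] init[OF iI] B.Comp_hom[OF _ f] B.Id_hom[OF iI] by metis
  obtain i where i: "i \<in> hom B I (Dom B f)" "f \<cdot>\<^bsub>B\<^esub> i = Id B I" using point fhg(2) by blast
  obtain j where j: "j \<in> hom B I (Dom B g)" "g \<cdot>\<^bsub>B\<^esub> j = Id B I" using point fhg(3) by blast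
  \<comment> \<open>Compatibility with the sections is free: both sides are arrows out of the
    initial object.\<close>
  have hi: "h \<cdot>\<^bsub>B\<^esub> i = j"
    using init[OF B.hom_Obj(1)[OF fhg(3)]] B.Comp_hom[OF i(1) fhg(4)] j(1) by blast
  have pt: "(OMap U x, AMap U p, AMap U s) \<in> pt_obj A (OMap U I)"
    if "p \<in> hom B x I" "s \<in> hom B I x" "p \<cdot>\<^bsub>B\<^esub> s = Id B I" for p x s
    using functor_Obj[OF U B.hom_Obj(1)[OF that(1)]] functor_hom[OF U that(1)] functor_hom[OF U that(2)]
      functor_Comp[OF U that(2,1)] functor_Id[OF U iI] that(3) unfolding pt_obj_def by simp
  have "is_iso A (AMap U h)"
  proof (rule A.protomodular_kernel_conservative[OF proto ker
        pt[OF fhg(2) i] pt[OF fhg(3) j] functor_hom[OF U fhg(4)]])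
    show "AMap U g \<cdot>\<^bsub>A\<^esub> AMap U h = AMap U f" using functor_Comp[OF U fhg(4,3)] fhg(5) by simp
    show "AMap U h \<cdot>\<^bsub>A\<^esub> AMap U i = AMap U j" using functor_Comp[OF U i(1) fhg(4)] hi by simp
    show "AMap K m \<in> hom A (Dom A (ker (AMap U f))) (Dom A (ker (AMap U g)))"
      using K_Arr(1)[OF fhg(6)] fhg(1) by (simp add: kernel_functor_def)
    show "ker (AMap U g) \<cdot>\<^bsub>A\<^esub> AMap K m = AMap U h \<cdot>\<^bsub>A\<^esub> ker (AMap U f)"
      using K_Arr(2)[OF fhg(6)] fhg(1) by simp
  qed (rule iso)
  then have "is_iso B h" using cons homD(1)[OF fhg(4)] unfolding conservative_def by blast
  then show "is_iso S m" unfolding fhg(1) by (rule B.is_iso_slice[OF fhg(6)])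
qed

section \<open>The augmentation functor into the slice\<close>

definition G where
  "G = \<lparr>OMap = aug, AMap = (\<lambda>f. (aug (Dom A f), AMap F f, aug (Cod A f)))\<rparr>"

lemma G_Obj: "OMap G = aug"
  unfolding G_def by simp

lemma G_Arr: "f \<in> hom A X Y \<Longrightarrow> AMap G f = (aug X, AMap F f, aug Y)"
  unfolding G_def by (simp add: homD)

lemma aug_Dom: "X \<in> Obj A \<Longrightarrow> Dom B (aug X) = OMap F X"
  using homD(2)[OF aug_hom] .

lemma G_hom: "f \<in> hom A X Y \<Longrightarrow> (aug X, AMap F f, aug Y) \<in> hom S (aug X) (aug Y)"
  using aug_hom[of X] aug_hom[of Y] A.hom_Obj[of f X Y] functor_hom[OF F, of f X Y]
    aug_natural[of f X Y] unfolding slice_hom by (simp add: aug_Dom)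

lemma G: "is_functor A S G"
proof (rule is_functorI[OF A.category_axioms category_slice[OF B.category_axioms]])
  fix X assume X: "X \<in> Obj A"
  show "OMap G X \<in> Obj S" unfolding G_Obj slice_Obj aug_Dom[OF X] by (rule aug_hom[OF X])
  show "AMap G (Id A X) = Id S (OMap G X)"
    using G_Arr[OF A.Id_hom[OF X]] functor_Id[OF F X]
    by (simp add: G_Obj slice_simps aug_Dom[OF X])
next
  fix f X Y assume f: "f \<in> hom A X Y"
  show "AMap G f \<in> hom S (OMap G X) (OMap G Y)" using G_Arr[OF f] G_hom[OF f] by (simp add: G_Obj)
  fix g W assume g: "g \<in> hom A Y W"
  show "AMap G (g \<cdot>\<^bsub>A\<^esub> f) = AMap G g \<cdot>\<^bsub>S\<^esub> AMap G f"
    using G_Arr[OF f] G_Arr[OF g] G_Arr[OF A.Comp_hom[OF f g]] functor_Comp[OF F f g]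
    by (simp add: slice_simps)
qed

section \<open>Unit and counit between \<open>G\<close> and \<open>K\<close>\<close>

lemma unit_kernel_comparison:
  assumes X: "X \<in> Obj A"
  shows "\<exists>!u. u \<in> hom A X (OMap K (aug X)) \<and> ker (AMap U (aug X)) \<cdot>\<^bsub>A\<^esub> u = \<eta> X"
  using ker_universal[OF aug_hom[OF X] unit_hom[OF X] aug_unit[OF X]] .

text \<open>The unit of the adjunction with left adjoint \<open>G\<close> and right adjoint
  \<open>K\<close>, obtained by factoring the original unit through the chosen kernel.\<close>

definition kunit where
  "kunit X = (THE u. u \<in> hom A X (OMap K (aug X)) \<and> ker (AMap U (aug X)) \<cdot>\<^bsub>A\<^esub> u = \<eta> X)"

lemma kunit:
  assumes "X \<in> Obj A"
  shows kunit_hom: "kunit X \<in> hom A X (OMap K (aug X))"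
    and ker_kunit: "ker (AMap U (aug X)) \<cdot>\<^bsub>A\<^esub> kunit X = \<eta> X"
  using theI'[OF unit_kernel_comparison[OF assms]] unfolding kunit_def by auto

text \<open>Under \<open>k\<close>, both \<open>\<eta> X\<close> and the chosen kernel are kernels
  of \<open>AMap U (aug X)\<close>, and \<open>kunit X\<close> is the comparison between them. The
  kernel hypothesis on \<open>\<eta>\<close> enters the proof through this lemma.\<close>

lemma kunit_iso:
  assumes X: "X \<in> Obj A" and k: "is_kernel A z (AMap U (aug X)) (\<eta> X)"
  shows "is_iso A (kunit X)"
proof (rule A.kernel_comparison_iso[OF k ker_kernel[OF aug_hom[OF X]] functor_hom[OF U aug_hom[OF X]]])
  show "kunit X \<in> hom A (Dom A (\<eta> X)) (Dom A (ker (AMap U (aug X))))"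
    using kunit_hom[OF X] homD(2)[OF unit_hom[OF X]] by (simp add: kernel_functor_def)
qed (rule ker_kunit[OF X])

text \<open>Composed with the monic kernel at \<open>Y\<close>, the square becomes the naturality
  square of \<open>\<eta>\<close>.\<close>

lemma kunit_natural:
  assumes f: "f \<in> hom A X Y"
  shows "kunit Y \<cdot>\<^bsub>A\<^esub> f = AMap K (aug X, AMap F f, aug Y) \<cdot>\<^bsub>A\<^esub> kunit X"
proof -
  note X = A.hom_Obj(1)[OF f] and Y = A.hom_Obj(2)[OF f]
  note m = G_hom[OF f]
  let ?k = "\<lambda>X. ker (AMap U (aug X))"
  show ?thesis
  proof (rule ker_cancel[OF aug_hom[OF Y] A.Comp_hom[OF f kunit_hom[OF Y]]
        A.Comp_hom[OF kunit_hom[OF X] K_Arr(1)[OF m]]])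
    have "?k Y \<cdot>\<^bsub>A\<^esub> (kunit Y \<cdot>\<^bsub>A\<^esub> f) = AMap U (AMap F f) \<cdot>\<^bsub>A\<^esub> \<eta> X"
      using A.Comp_assoc[OF f kunit_hom[OF Y] ker_hom[OF aug_hom[OF Y]]] ker_kunit[OF Y]
        unit_natural[OF f] by simp
    also have "\<dots> = (?k Y \<cdot>\<^bsub>A\<^esub> AMap K (aug X, AMap F f, aug Y)) \<cdot>\<^bsub>A\<^esub> kunit X"
      using A.Comp_assoc[OF kunit_hom[OF X] ker_hom[OF aug_hom[OF X]]
          functor_hom[OF U functor_hom[OF F f]]] ker_kunit[OF X] K_Arr(2)[OF m] by simp
    finally show "?k Y \<cdot>\<^bsub>A\<^esub> (kunit Y \<cdot>\<^bsub>A\<^esub> f)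
        = ?k Y \<cdot>\<^bsub>A\<^esub> (AMap K (aug X, AMap F f, aug Y) \<cdot>\<^bsub>A\<^esub> kunit X)"
      using A.Comp_assoc[OF kunit_hom[OF X] K_Arr(1)[OF m] ker_hom[OF aug_hom[OF Y]]] by simp
  qed
qed

text \<open>The underlying arrow in \<open>B\<close> of the counit at \<open>f\<close>: the
  transpose, under the adjunction of \<open>F\<close> and \<open>U\<close>, of the kernel inclusion
  \<open>ker (AMap U f)\<close>.\<close>

definition kcounit where
  "kcounit f = (THE g. g \<in> hom B (OMap F (OMap K f)) (Dom B f) \<and>
     AMap U g \<cdot>\<^bsub>A\<^esub> \<eta> (OMap K f) = ker (AMap U f))"

context
  fixes f assumes f: "f \<in> hom B (Dom B f) I"
begin

lemma K_Obj: "OMap K f \<in> Obj A"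
  using A.hom_Obj(1)[OF ker_hom[OF f]] .

lemma kcounit_hom: "kcounit f \<in> hom B (OMap F (OMap K f)) (Dom B f)"
  and kcounit_unit: "AMap U (kcounit f) \<cdot>\<^bsub>A\<^esub> \<eta> (OMap K f) = ker (AMap U f)"
  using theI'[OF left_adjoint_universal[OF adj K_Obj B.hom_Obj(1)[OF f] ker_hom[OF f]]]
  unfolding kcounit_def by auto

text \<open>The transpose of \<open>f \<cdot> kcounit f\<close> is \<open>AMap U f\<close> composed
  with its own kernel, hence zero; by \<open>aug_unique\<close> the composite is the
  augmentation.\<close>

lemma kcounit_slice: "(aug (OMap K f), kcounit f, f) \<in> hom S (aug (OMap K f)) f"
proof -
  note e = kcounit_hom and k = K_Obj
  have "f \<cdot>\<^bsub>B\<^esub> kcounit f = aug (OMap K f)"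
  proof (rule aug_unique[OF k B.Comp_hom[OF e f]])
    show "AMap U (f \<cdot>\<^bsub>B\<^esub> kcounit f) \<cdot>\<^bsub>A\<^esub> \<eta> (OMap K f) = zero_arrow A z (OMap K f) (OMap U I)"
      using functor_Comp[OF U e f] kcounit_unit ker_zero[OF f]
        A.Comp_assoc[OF unit_hom[OF k] functor_hom[OF U e] functor_hom[OF U f]] by simp
  qed
  then show ?thesis using e f aug_hom[OF k] unfolding slice_hom by (simp add: aug_Dom[OF k])
qed

text \<open>A triangle identity. Composed with the monic \<open>ker (AMap U f)\<close>, the left
  side becomes the transpose of \<open>kcounit f\<close>, which is that kernel itself.\<close>

lemma K_kcounit_kunit: "AMap K (aug (OMap K f), kcounit f, f) \<cdot>\<^bsub>A\<^esub> kunit (OMap K f) = Id A (OMap K f)"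
proof -
  note m = K_Arr[OF kcounit_slice] and n = kunit[OF K_Obj] and p = aug_hom[OF K_Obj]
  show ?thesis
    by (rule ker_cancel[OF f A.Comp_hom[OF n(1) m(1)] A.Id_hom[OF K_Obj]])
      (use A.Comp_assoc[OF n(1) m(1) ker_hom[OF f]] m(2) n(2) kcounit_unit A.Comp_Id[OF ker_hom[OF f]]
        A.Comp_assoc[OF n(1) ker_hom[OF p] functor_hom[OF U kcounit_hom]] in simp)
qed

text \<open>By the triangle identity, \<open>K\<close> sends the counit to a left inverse of the
  invertible \<open>kunit\<close>, hence to an isomorphism, which \<open>K\<close> reflects.\<close>

lemma kcounit_iso:
  assumes "is_kernel A z (AMap U (aug (OMap K f))) (\<eta> (OMap K f))"
    and "protomodular A" "conservative B A U"
  shows "is_iso S (aug (OMap K f), kcounit f, f)"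
proof -
  have "is_iso A (AMap K (aug (OMap K f), kcounit f, f))"
    by (rule A.is_iso_left_inverse[OF kunit_iso[OF K_Obj assms(1)] kunit_hom[OF K_Obj]
          K_Arr(1)[OF kcounit_slice] K_kcounit_kunit])
  then show ?thesis
    using K_conservative[OF assms(2,3)] homD(1)[OF kcounit_slice] unfolding conservative_def by blast
qed

end

text \<open>Both sides have the transpose \<open>AMap U h \<cdot> ker (AMap U f)\<close>: the left
  one by naturality of \<open>\<eta>\<close> and \<open>K_Arr\<close>, the right one by the
  definition of \<open>kcounit f\<close>.\<close>

lemma kcounit_natural:
  assumes m: "(f, h, g) \<in> hom S f g"
  shows "kcounit g \<cdot>\<^bsub>B\<^esub> AMap F (AMap K (f, h, g)) = h \<cdot>\<^bsub>B\<^esub> kcounit f"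
proof -
  have f: "f \<in> hom B (Dom B f) I" and g: "g \<in> hom B (Dom B g) I"
    and h: "h \<in> hom B (Dom B f) (Dom B g)"
    using m unfolding slice_hom by auto
  let ?u = "AMap K (f, h, g)"
  note u = K_Arr(1)[OF m] and Xf = K_Obj[OF f] and Xg = K_Obj[OF g]
  note Fu = functor_hom[OF F u] and ef = kcounit_hom[OF f] and eg = kcounit_hom[OF g]
  show ?thesis
  proof (rule transpose_cancel[OF Xf B.Comp_hom[OF Fu eg] B.Comp_hom[OF ef h]])
    have "AMap U (kcounit g \<cdot>\<^bsub>B\<^esub> AMap F ?u) \<cdot>\<^bsub>A\<^esub> \<eta> (OMap K f)
        = AMap U (kcounit g) \<cdot>\<^bsub>A\<^esub> (\<eta> (OMap K g) \<cdot>\<^bsub>A\<^esub> ?u)"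
      using functor_Comp[OF U Fu eg] unit_natural[OF u]
        A.Comp_assoc[OF unit_hom[OF Xf] functor_hom[OF U Fu] functor_hom[OF U eg]] by simp
    also have "\<dots> = AMap U h \<cdot>\<^bsub>A\<^esub> ker (AMap U f)"
      using A.Comp_assoc[OF u unit_hom[OF Xg] functor_hom[OF U eg]] kcounit_unit[OF g] K_Arr(2)[OF m]
      by simp
    also have "\<dots> = AMap U (h \<cdot>\<^bsub>B\<^esub> kcounit f) \<cdot>\<^bsub>A\<^esub> \<eta> (OMap K f)"
      using functor_Comp[OF U ef h] kcounit_unit[OF f]
        A.Comp_assoc[OF unit_hom[OF Xf] functor_hom[OF U ef] functor_hom[OF U h]] by simp
    finally show "AMap U (kcounit g \<cdot>\<^bsub>B\<^esub> AMap F ?u) \<cdot>\<^bsub>A\<^esub> \<eta> (OMap K f)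
        = AMap U (h \<cdot>\<^bsub>B\<^esub> kcounit f) \<cdot>\<^bsub>A\<^esub> \<eta> (OMap K f)" .
  qed
qed

lemma K_equivalence:
  assumes proto: "protomodular A" and cons: "conservative B A U"
    and unit: "\<And>X. X \<in> Obj A \<Longrightarrow> is_kernel A z (AMap U (aug X)) (\<eta> X)"
  shows "equivalence_of_categories S A K"
proof -
  interpret S: category S using category_slice[OF B.category_axioms] .
  \<comment> \<open>The counit as an arrow of the slice, with source \<open>G\<close> applied to
    \<open>K f\<close>.\<close>
  let ?e = "\<lambda>f. (aug (OMap K f), kcounit f, f)"
  have "nat_trans A A id_functor (comp_functor K G) kunit"
    unfolding nat_trans_def
  proof (intro conjI ballI is_functor_id[OF A.category_axioms] is_functor_comp[OF G K])
    fix f assume "f \<in> Arr A"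
    then have f: "f \<in> hom A (Dom A f) (Cod A f)" by (simp add: hom_def)
    show "kunit (Cod A f) \<cdot>\<^bsub>A\<^esub> AMap id_functor f = AMap (comp_functor K G) f \<cdot>\<^bsub>A\<^esub> kunit (Dom A f)"
      using kunit_natural[OF f] G_Arr[OF f] by (simp add: id_functor_def comp_functor_def)
  qed (auto simp: id_functor_def comp_functor_def G_Obj intro: kunit_hom)
  then have "nat_iso A A id_functor (comp_functor K G) kunit"
    unfolding nat_iso_def using kunit_iso unit by blast
  moreover have "nat_trans S S (comp_functor G K) id_functor ?e"
    unfolding nat_trans_def
  proof (intro conjI ballI is_functor_id[OF S.category_axioms] is_functor_comp[OF K G])
    fix f assume "f \<in> Obj S"
    then show "?e f \<in> hom S (OMap (comp_functor G K) f) (OMap id_functor f)"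
      using kcounit_slice unfolding slice_Obj by (simp add: id_functor_def comp_functor_def G_Obj)
  next
    fix m assume "m \<in> Arr S"
    then have m: "m \<in> hom S (Dom S m) (Cod S m)" by (simp add: hom_def)
    obtain f h g where fhg: "m = (f, h, g)" by (cases m)
    then have m': "(f, h, g) \<in> hom S f g" using m slice_hom by metis
    show "?e (Cod S m) \<cdot>\<^bsub>S\<^esub> AMap (comp_functor G K) m = AMap id_functor m \<cdot>\<^bsub>S\<^esub> ?e (Dom S m)"
      using homD[OF m'] G_Arr[OF K_Arr(1)[OF m']] kcounit_natural[OF m'] unfolding fhg
      by (simp add: id_functor_def comp_functor_def slice_simps)
  qed
  moreover have "is_iso S (?e f)" if "f \<in> Obj S" for f
    using that kcounit_iso[OF _ unit[OF K_Obj] proto cons] unfolding slice_Obj by blast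
  ultimately have n: "nat_iso A A id_functor (comp_functor K G) kunit"
    and e: "nat_iso S S (comp_functor G K) id_functor ?e"
    unfolding nat_iso_def by auto
  \<comment> \<open>\<open>G\<close> is the quasi-inverse. Unit and counit point against the
    directions required of an equivalence, so both are inverted.\<close>
  then show ?thesis
    unfolding equivalence_of_categories_def using K G nat_iso_sym[OF n] nat_iso_sym[OF e] by blast
qed

end

theorem theorem3p13:
  fixes A :: "('oa, 'ma) category" and B :: "('ob, 'mb) category"
    and U :: "('ob, 'mb, 'oa, 'ma) functor_maps" and F :: "('oa, 'ma, 'ob, 'mb) functor_maps"
    and \<eta> :: "'oa \<Rightarrow> 'ma" and z :: 'oa and ker :: "'ma \<Rightarrow> 'ma"
  assumes "homological A"
    and "is_zero_object A z"
    and "category B"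
    and "is_functor B A U"
    and "conservative B A U"
    and "faithful B A U"
    and "left_adjoint_with_unit A B F U \<eta>"
    and "\<forall>X \<in> Obj A. is_kernel A z (AMap U (augmentation A B F U \<eta> z X)) (\<eta> X)"
    and "kernel_choice A z ker"
  shows "equivalence_of_categories (slice B (OMap F z)) A (kernel_functor B A U ker)"
proof -
  have "category A" and proto: "protomodular A"
    using assms(1) unfolding homological_def by auto
  then interpret kernel_adjunction A B z U F \<eta> ker
    using assms by (intro kernel_adjunction.intro category_with_zero.intro
        category_with_zero_axioms.intro kernel_adjunction_axioms.intro)
  show ?thesis using K_equivalence[OF proto assms(5)] assms(8) by blast
qed

end
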